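(* Let $R=\mathbb{Z}$ or $R=\mathbb{F}_p$ ($p$ prime). Let $\mathcal{M}=\mathsf{T}_R(\mathbf{X})$ be a colimit of Hirsch extensions, and let $Y$ be a $\Delta$-set. There is a bijection, natural in both $Y$ and $\mathcal{M}$, $$\mathrm{Hom}_{\Delta\text{-set}}(Y,\,BG(\mathcal{M}))\cong\mathrm{Hom}_{\text{bin. }\cup_1\text{-dga}}(\mathcal{M},\,C^*(|Y|;R)).$$ Under this bijection a morphism $f\colon\mathcal{M}\to C^*(|Y|;R)$ corresponds to the map $r(f)\colon Y\to BG(\mathcal{M})$ given on $n$-simplices, $n\ge 1$, by $$r(f)_n(y)=[\,r(f)(y)(0,1)\mid r(f)(y)(1,2)\mid\cdots\mid r(f)(y)(n-1,n)\,],$$ where $r(f)(y)(j,j+1)\in G(\mathcal{M})$ is the function sending $x\in\mathbf{X}$ to the value of $f(x)$ on the edge $(j,j+1)$ of $y$; and $f=|r(f)|^\#\circ\psi$, where $\psi\colon\mathcal{M}\to C^*(|BG(\mathcal{M})|;R)$ is the canonical morphism. Naturality in $Y$ means that for every map $t\colon Y\to Z$ of $\Delta$-sets the bijections for $Z$ and $Y$ intertwine precomposition with $t$, $\mathrm{Hom}(Z,BG(\mathcal{M}))\to\mathrm{Hom}(Y,BG(\mathcal{M}))$, with postcomposition with $|t|^\#$, $\mathrm{Hom}(\mathcal{M},C^*(|Z|;R))\to\mathrm{Hom}(\mathcal{M},C^*(|Y|;R))$. Naturality in $\mathcal{M}$ means that for every morphism $\alpha\colon\mathcal{M}\to\mathcal{M}'$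 of binomial $\cup_1$-dgas between colimits of Hirsch extensions, the bijections for $\mathcal{M}'$ and $\mathcal{M}$ intertwine postcomposition with $B\bar\alpha$, $\mathrm{Hom}(Y,BG(\mathcal{M}'))\to\mathrm{Hom}(Y,BG(\mathcal{M}))$, with precomposition with $\alpha$, $\mathrm{Hom}(\mathcal{M}',C^*(|Y|;R))\to\mathrm{Hom}(\mathcal{M},C^*(|Y|;R))$, where $\bar\alpha\colon G(\mathcal{M}')\to G(\mathcal{M})$ is the homomorphism induced by $\alpha$.
   Context: Throughout $R=\mathbb{Z}$ or $\mathbb{F}_p$. **Binomial $\cup_1$-dgas.** A $\mathbb{Z}$-binomial ring is a commutative ring $B$, torsion-free as an abelian group, with $\binom{b}{n}=b(b-1)\cdots(b-n+1)/n!\in B$ for all $b\in B$, $n\ge 0$; an $\mathbb{F}_p$-binomial ring is a commutative $\mathbb{F}_p$-algebra $B$ with $b(b-1)\cdots(b-p+1)=0$ for all $b\in B$. Write $\zeta_n(b)=\binom{b}{n}$ ($0\le n\le p-1$ if $R=\mathbb{F}_p$). An $R$-binomial $\cup_1$-graded algebra is a graded associative unital $R$-algebra $A=\bigoplus_{i\ge 0}A^i$ (product $\cup$) with an $R$-bilinear product $\cup_1\colon A^1\times A^1\to A^1$ such that $R\oplus A^1$ with product $(r,a)(s,b)=(rs,\,rb+sa+a\cup_1 b)$ is an $R$-binomial ring, and, with $D^2\subset A^2$ the span of all $a\cup b$ ($a,b\in A^1$), with bilinear maps $\cup_1\colon D^2\times A^1\to D^2$ and $\circ\colon D^2\times D^2\to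 D^2$ satisfying $(a\cup b)\cup_1 c=a\cup(b\cup_1 c)+(a\cup_1 c)\cup b$ and $(a\cup b)\circ(a'\cup b')=(a\cup_1 a')\cup(b\cup_1 b')$. An $R$-binomial $\cup_1$-dga is such an $A$ with a degree $1$ differential $d$, $d^2=0$, satisfying the Leibniz rule and $d(a\cup_1 b)=-a\cup b-b\cup a+da\cup_1 b+db\cup_1 a-da\circ db$ for $a,b\in A^1$ with $da,db\in D^2$. Morphisms preserve all structure. **$\Delta$-sets and cochains.** A $\Delta$-set is a sequence of sets $Y_n$, $n\ge0$, with face maps $d_i\colon Y_n\to Y_{n-1}$ ($0\le i\le n$), $d_id_j=d_{j-1}d_i$ for $i<j$; maps commute with faces; $|Y|$ is the realization. $C^*(|Y|;R)$ is the ordered simplicial cochain algebra of $Y$ with coboundary $(d\alpha)(\sigma)=\sum_i(-1)^i\alpha(d_i\sigma)$ and Alexander–Whitney cup product; on $1$-cochains $(u\cup_1 v)(e)=u(e)v(e)$ and $\zeta_n(u)(e)=\binom{u(e)}{n}$. It is an $R$-binomial $\cup_1$-dga. A map $t\colon Y\to Z$ of $\Delta$-sets induces $|t|^\#\colon C^*(|Z|;R)\to C^*(|Y|;R)$. For a group $H$, $BH$ is the $\Delta$-set with one vertex, $n$-simplices $[h_1|\cdots|h_n]$, and $d_0=[h_2|\cdots|h_n]$, $d_i=[h_1|\cdots|h_ih_{i+1}|\cdots|h_n]$ ($1\le i\le n-1$), $d_n=[h_1|\cdots|h_{n-1}]$. **Free objects, Hirsch extensions.** For a set $\mathbf{X}$,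 let $\mathsf{T}_R^1(\mathbf{X})$ be the ideal of elements with zero constant term in the ring of integer-valued polynomials $\{q\in\mathbb{Q}[\mathbf{X}]: q(\mathbb{Z}^{\mathbf X})\subset\mathbb{Z}\}$ if $R=\mathbb{Z}$, or in $\mathbb{F}_p[\mathbf{X}]/(x^p-x: x\in\mathbf{X})$ if $R=\mathbb{F}_p$; $\mathsf{T}_R(\mathbf{X})$ is the tensor algebra over $R$ of $\mathsf{T}^1_R(\mathbf{X})$, with $\cup=\otimes$ and with $\cup_1$ on degree $1$ the product of polynomials. It is the free $R$-binomial $\cup_1$-graded algebra on $\mathbf{X}$: a map of sets $\mathbf{X}\to A^1$ extends uniquely to a morphism $\mathsf{T}_R(\mathbf{X})\to A$ of such algebras. If $\mathsf{T}_R(\mathbf{X})$ has a binomial $\cup_1$-dga differential and $f\colon\mathbf{Y}\to Z^2(\mathsf{T}_R(\mathbf{X}))$ is a map of sets into the $2$-cocycles, there is a unique binomial $\cup_1$-dga differential on $\mathsf{T}_R(\mathbf{X}\sqcup\mathbf{Y})$ extending it with $dy=f(y)$; the result is a Hirsch extension. A colimit of Hirsch extensions is $\mathcal{M}=\mathsf{T}_R(\mathbf{X})=\varinjlim\mathcal{M}_n$, $\mathcal{M}_n=\mathsf{T}_R(\mathbf{X}^n)$, $\mathbf{X}^n=\mathbf{X}_1\sqcup\cdots\sqcup\mathbf{X}_n$, $\mathbf X=\bigcup\mathbf X^n$, with $dx=0$ for $x\in\mathbf{X}_1$ and $\mathcal{M}_{n+1}$ a Hirsch extension of $\mathcal{M}_n$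 by $\mathbf{X}_{n+1}$ (possibly empty). **Groups.** Elements of $\mathsf{T}^1_R(\mathbf{X})$ are evaluated on functions $\mathbf{a}\colon\mathbf{X}\to R$. The group $G(\mathcal{M})$ is the set of functions $\mathbf{X}\to R$ with product $(\mathbf{a}\cdot\mathbf{b})(x)=\mathbf{a}(x)+\mathbf{b}(x)-\sum_i p_{x,i}(\mathbf{a})q_{x,i}(\mathbf{b})$, where $dx=\sum_i p_{x,i}\otimes q_{x,i}$. A morphism $\alpha\colon\mathcal{M}\to\mathcal{M}'$ induces the homomorphism $\bar\alpha\colon G(\mathcal{M}')\to G(\mathcal{M})$, $\bar\alpha(\mathbf{a})(x)=\alpha(x)(\mathbf{a})$. The canonical morphism $\psi\colon\mathcal{M}\to C^*(|BG(\mathcal{M})|;R)$ is determined by $\psi(x)([\mathbf{a}])=\mathbf{a}(x)$ for $x\in\mathbf{X}$, $\mathbf{a}\in G(\mathcal{M})$. *)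

theory Defs
  imports
    "HOL-Algebra.Module"
    "HOL-Algebra.QuotRing"
    "HOL-Library.Poly_Mapping"
    "Berlekamp_Zassenhaus.Finite_Field"
begin

text \<open>
  The coefficient ring \<open>R\<close> is a type of class \<^class>\<open>comm_ring_1\<close>; it is used at \<^typ>\<open>int\<close> and at
  \<open>'p mod_ring\<close> with \<open>'p :: prime_card\<close>, which is the field with \<open>CARD('p)\<close> elements.
  Graded objects are families indexed by the degree, and maps of graded objects are families of maps.
  Maps on carriers are extensional (they are \<^const>\<open>undefined\<close> outside the carrier),
  so that a set of maps contains every map once.
\<close>

definition base_ring :: "'r::comm_ring_1 ring" where
  "base_ring = \<lparr>carrier = UNIV, monoid.mult = (*), one = 1, ring.zero = 0, ring.add = (+)\<rparr>"

definition is_linear ::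
  "('r, 'a, 's) module_scheme \<Rightarrow> ('r, 'b, 't) module_scheme \<Rightarrow> ('a \<Rightarrow> 'b) \<Rightarrow> bool" where
  "is_linear M N f \<longleftrightarrow>
     f \<in> carrier M \<rightarrow> carrier N \<and>
     (\<forall>x\<in>carrier M. \<forall>y\<in>carrier M. f (x \<oplus>\<^bsub>M\<^esub> y) = f x \<oplus>\<^bsub>N\<^esub> f y) \<and>
     (\<forall>r. \<forall>x\<in>carrier M. f (r \<odot>\<^bsub>M\<^esub> x) = r \<odot>\<^bsub>N\<^esub> f x)"

definition is_bilinear ::
  "('r, 'a, 's) module_scheme \<Rightarrow> ('r, 'b, 't) module_scheme \<Rightarrow> ('r, 'c, 'u) module_scheme \<Rightarrow>
   ('a \<Rightarrow> 'b \<Rightarrow> 'c) \<Rightarrow> bool" where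
  "is_bilinear M N L f \<longleftrightarrow>
     (\<forall>x\<in>carrier M. is_linear N L (f x)) \<and> (\<forall>y\<in>carrier N. is_linear M L (\<lambda>x. f x y))"


section \<open>Binomial cup-one dgas\<close>

definition falling_factorial :: "('b, 's) ring_scheme \<Rightarrow> 'b \<Rightarrow> nat \<Rightarrow> 'b" where
  "falling_factorial B b n = (\<Otimes>\<^bsub>B\<^esub>i\<in>{..<n}. b \<ominus>\<^bsub>B\<^esub> [i] \<cdot>\<^bsub>B\<^esub> \<one>\<^bsub>B\<^esub>)"

definition Z_binomial_ring :: "('b, 's) ring_scheme \<Rightarrow> bool" where
  "Z_binomial_ring B \<longleftrightarrow>
     cring B \<and>
     (\<forall>b\<in>carrier B. \<forall>n::nat. 0 < n \<and> [n] \<cdot>\<^bsub>B\<^esub> b = \<zero>\<^bsub>B\<^esub> \<longrightarrow> b = \<zero>\<^bsub>B\<^esub>) \<and>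
     (\<forall>b\<in>carrier B. \<forall>n. \<exists>c\<in>carrier B. [(fact n :: nat)] \<cdot>\<^bsub>B\<^esub> c = falling_factorial B b n)"

definition Fp_binomial_ring :: "nat \<Rightarrow> ('b, 's) ring_scheme \<Rightarrow> bool" where
  "Fp_binomial_ring p B \<longleftrightarrow>
     cring B \<and>
     [p] \<cdot>\<^bsub>B\<^esub> \<one>\<^bsub>B\<^esub> = \<zero>\<^bsub>B\<^esub> \<and>
     (\<forall>b\<in>carrier B. falling_factorial B b p = \<zero>\<^bsub>B\<^esub>)"

text \<open>
  In the following record, \<open>cup1\<close> is the product \<open>A\<^sup>1 \<times> A\<^sup>1 \<rightarrow> A\<^sup>1\<close>, \<open>dcup1\<close> is
  \<open>\<union>\<^sub>1 : D\<^sup>2 \<times> A\<^sup>1 \<rightarrow> D\<^sup>2\<close>, and \<open>circ\<close> is \<open>\<circ> : D\<^sup>2 \<times> D\<^sup>2 \<rightarrow> D\<^sup>2\<close>; their values on other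
  arguments are irrelevant.  The ring fields \<^const>\<open>monoid.mult\<close> and \<^const>\<open>one\<close> of the modules \<open>comp A n\<close> are
  not used.
\<close>

record ('r, 'a) cup1_algebra =
  comp  :: "nat \<Rightarrow> ('r, 'a) module"
  unit  :: "'a"
  cup   :: "nat \<Rightarrow> nat \<Rightarrow> 'a \<Rightarrow> 'a \<Rightarrow> 'a"
  cup1  :: "'a \<Rightarrow> 'a \<Rightarrow> 'a"
  dcup1 :: "'a \<Rightarrow> 'a \<Rightarrow> 'a"
  circ  :: "'a \<Rightarrow> 'a \<Rightarrow> 'a"

record ('r, 'a) cup1_dga = "('r, 'a) cup1_algebra" +
  diff :: "nat \<Rightarrow> 'a \<Rightarrow> 'a"

abbreviation comps :: "('r, 'a, 's) cup1_algebra_scheme \<Rightarrow> nat \<Rightarrow> 'a set" where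
  "comps A n \<equiv> carrier (comp A n)"

inductive_set decomposables :: "('r, 'a, 's) cup1_algebra_scheme \<Rightarrow> 'a set"
  for A :: "('r, 'a, 's) cup1_algebra_scheme" where
  zero: "\<zero>\<^bsub>comp A 2\<^esub> \<in> decomposables A"
| cup: "a \<in> comps A 1 \<Longrightarrow> b \<in> comps A 1 \<Longrightarrow> cup A 1 1 a b \<in> decomposables A"
| add: "u \<in> decomposables A \<Longrightarrow> v \<in> decomposables A \<Longrightarrow> u \<oplus>\<^bsub>comp A 2\<^esub> v \<in> decomposables A"
| smult: "u \<in> decomposables A \<Longrightarrow> r \<odot>\<^bsub>comp A 2\<^esub> u \<in> decomposables A"

definition D2 :: "('r, 'a, 's) cup1_algebra_scheme \<Rightarrow> ('r, 'a) module" where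
  "D2 A = (comp A 2)\<lparr>carrier := decomposables A\<rparr>"

definition unitization :: "('r::comm_ring_1, 'a, 's) cup1_algebra_scheme \<Rightarrow> ('r \<times> 'a) ring" where
  "unitization A =
     \<lparr>carrier = UNIV \<times> comps A 1,
      monoid.mult = (\<lambda>(r, a) (s, b). (r * s, (r \<odot>\<^bsub>comp A 1\<^esub> b \<oplus>\<^bsub>comp A 1\<^esub> s \<odot>\<^bsub>comp A 1\<^esub> a) \<oplus>\<^bsub>comp A 1\<^esub> cup1 A a b)),
      one = (1, \<zero>\<^bsub>comp A 1\<^esub>),
      ring.zero = (0, \<zero>\<^bsub>comp A 1\<^esub>),
      ring.add = (\<lambda>(r, a) (s, b). (r + s, a \<oplus>\<^bsub>comp A 1\<^esub> b))\<rparr>"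

definition graded_algebra :: "('r::comm_ring_1, 'a, 's) cup1_algebra_scheme \<Rightarrow> bool" where
  "graded_algebra A \<longleftrightarrow>
     (\<forall>n. module base_ring (comp A n)) \<and>
     unit A \<in> comps A 0 \<and>
     (\<forall>i j. is_bilinear (comp A i) (comp A j) (comp A (i + j)) (cup A i j)) \<and>
     (\<forall>i j k. \<forall>a\<in>comps A i. \<forall>b\<in>comps A j. \<forall>c\<in>comps A k.
        cup A (i + j) k (cup A i j a b) c = cup A i (j + k) a (cup A j k b c)) \<and>
     (\<forall>i. \<forall>a\<in>comps A i. cup A 0 i (unit A) a = a \<and> cup A i 0 a (unit A) = a)"

definition binomial_cup1_algebra :: "('r::comm_ring_1, 'a, 's) cup1_algebra_scheme \<Rightarrow> bool" where
  "binomial_cup1_algebra A \<longleftrightarrow>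
     graded_algebra A \<and>
     is_bilinear (comp A 1) (comp A 1) (comp A 1) (cup1 A) \<and>
     (if CHAR('r) = 0 then Z_binomial_ring (unitization A)
      else Fp_binomial_ring CHAR('r) (unitization A)) \<and>
     is_bilinear (D2 A) (comp A 1) (D2 A) (dcup1 A) \<and>
     is_bilinear (D2 A) (D2 A) (D2 A) (circ A) \<and>
     (\<forall>a\<in>comps A 1. \<forall>b\<in>comps A 1. \<forall>c\<in>comps A 1.
        dcup1 A (cup A 1 1 a b) c =
          cup A 1 1 a (cup1 A b c) \<oplus>\<^bsub>comp A 2\<^esub> cup A 1 1 (cup1 A a c) b) \<and>
     (\<forall>a\<in>comps A 1. \<forall>b\<in>comps A 1. \<forall>a'\<in>comps A 1. \<forall>b'\<in>comps A 1.
        circ A (cup A 1 1 a b) (cup A 1 1 a' b') = cup A 1 1 (cup1 A a a') (cup1 A b b'))"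

definition binomial_cup1_dga :: "('r::comm_ring_1, 'a, 's) cup1_dga_scheme \<Rightarrow> bool" where
  "binomial_cup1_dga A \<longleftrightarrow>
     binomial_cup1_algebra A \<and>
     (\<forall>n. is_linear (comp A n) (comp A (Suc n)) (diff A n)) \<and>
     (\<forall>n. \<forall>a\<in>comps A n. diff A (Suc n) (diff A n a) = \<zero>\<^bsub>comp A (Suc (Suc n))\<^esub>) \<and>
     (\<forall>i j. \<forall>a\<in>comps A i. \<forall>b\<in>comps A j.
        diff A (i + j) (cup A i j a b) =
          cup A (Suc i) j (diff A i a) b
          \<oplus>\<^bsub>comp A (Suc (i + j))\<^esub> (-1) ^ i \<odot>\<^bsub>comp A (Suc (i + j))\<^esub> cup A i (Suc j) a (diff A j b)) \<and>
     (\<forall>a\<in>comps A 1. \<forall>b\<in>comps A 1.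
        diff A 1 a \<in> decomposables A \<and> diff A 1 b \<in> decomposables A \<longrightarrow>
        diff A 1 (cup1 A a b) =
          (\<ominus>\<^bsub>comp A 2\<^esub> cup A 1 1 a b) \<ominus>\<^bsub>comp A 2\<^esub> cup A 1 1 b a
          \<oplus>\<^bsub>comp A 2\<^esub> dcup1 A (diff A 1 a) b \<oplus>\<^bsub>comp A 2\<^esub> dcup1 A (diff A 1 b) a
          \<ominus>\<^bsub>comp A 2\<^esub> circ A (diff A 1 a) (diff A 1 b))"

text \<open>
  The operations \<open>\<zeta>\<^sub>n\<close> are determined by the ring structure of \<^const>\<open>unitization\<close>, so that
  morphisms preserve them automatically.
\<close>

definition dga_hom ::
  "('r, 'a, 's) cup1_dga_scheme \<Rightarrow> ('r, 'b, 't) cup1_dga_scheme \<Rightarrow> (nat \<Rightarrow> 'a \<Rightarrow> 'b) set" where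
  "dga_hom A B = {h.
     (\<forall>n. h n \<in> extensional (comps A n) \<and> is_linear (comp A n) (comp B n) (h n)) \<and>
     h 0 (unit A) = unit B \<and>
     (\<forall>i j. \<forall>a\<in>comps A i. \<forall>b\<in>comps A j. h (i + j) (cup A i j a b) = cup B i j (h i a) (h j b)) \<and>
     (\<forall>a\<in>comps A 1. \<forall>b\<in>comps A 1. h 1 (cup1 A a b) = cup1 B (h 1 a) (h 1 b)) \<and>
     (\<forall>u\<in>decomposables A. \<forall>c\<in>comps A 1. h 2 (dcup1 A u c) = dcup1 B (h 2 u) (h 1 c)) \<and>
     (\<forall>u\<in>decomposables A. \<forall>v\<in>decomposables A. h 2 (circ A u v) = circ B (h 2 u) (h 2 v)) \<and>
     (\<forall>n. \<forall>a\<in>comps A n. h (Suc n) (diff A n a) = diff B n (h n a))}"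

definition dga_comp ::
  "('r, 'a, 's) cup1_dga_scheme \<Rightarrow> (nat \<Rightarrow> 'b \<Rightarrow> 'c) \<Rightarrow> (nat \<Rightarrow> 'a \<Rightarrow> 'b) \<Rightarrow> nat \<Rightarrow> 'a \<Rightarrow> 'c" where
  "dga_comp A g f = (\<lambda>n. compose (comps A n) (g n) (f n))"


section \<open>Delta-sets and their cochains\<close>

text \<open>\<open>face Y n i\<close> is the face map \<open>d\<^sub>i : Y\<^sub>n \<rightarrow> Y\<^sub>n\<^sub>-\<^sub>1\<close>.\<close>

record 'y delta =
  simplices :: "nat \<Rightarrow> 'y set"
  face      :: "nat \<Rightarrow> nat \<Rightarrow> 'y \<Rightarrow> 'y"

definition delta_set :: "'y delta \<Rightarrow> bool" where
  "delta_set Y \<longleftrightarrow>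
     (\<forall>n. \<forall>i\<le>Suc n. face Y (Suc n) i \<in> simplices Y (Suc n) \<rightarrow> simplices Y n) \<and>
     (\<forall>n i j. i < j \<and> j \<le> Suc (Suc n) \<longrightarrow>
        (\<forall>y\<in>simplices Y (Suc (Suc n)).
           face Y (Suc n) i (face Y (Suc (Suc n)) j y) =
           face Y (Suc n) (j - 1) (face Y (Suc (Suc n)) i y)))"

definition delta_maps :: "'y delta \<Rightarrow> 'z delta \<Rightarrow> (nat \<Rightarrow> 'y \<Rightarrow> 'z) set" where
  "delta_maps Y Z = {t.
     (\<forall>n. t n \<in> simplices Y n \<rightarrow>\<^sub>E simplices Z n) \<and>
     (\<forall>n. \<forall>i\<le>Suc n. \<forall>y\<in>simplices Y (Suc n).
        t n (face Y (Suc n) i y) = face Z (Suc n) i (t (Suc n) y))}"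

definition delta_comp ::
  "'x delta \<Rightarrow> (nat \<Rightarrow> 'y \<Rightarrow> 'z) \<Rightarrow> (nat \<Rightarrow> 'x \<Rightarrow> 'y) \<Rightarrow> nat \<Rightarrow> 'x \<Rightarrow> 'z" where
  "delta_comp X s t = (\<lambda>n. compose (simplices X n) (s n) (t n))"

text \<open>
  For a simplex \<open>y\<close> with vertices \<open>0, \<dots>, k + m\<close>, \<open>front_face Y k m y\<close> is the face with vertices
  \<open>0, \<dots>, k\<close> and \<open>back_face Y k m y\<close> is the face with vertices \<open>m, \<dots>, k + m\<close>.
\<close>

fun front_face :: "'y delta \<Rightarrow> nat \<Rightarrow> nat \<Rightarrow> 'y \<Rightarrow> 'y" where
  "front_face Y k 0 y = y"
| "front_face Y k (Suc m) y = front_face Y k m (face Y (k + Suc m) (k + Suc m) y)"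

fun back_face :: "'y delta \<Rightarrow> nat \<Rightarrow> nat \<Rightarrow> 'y \<Rightarrow> 'y" where
  "back_face Y k 0 y = y"
| "back_face Y k (Suc m) y = back_face Y k m (face Y (k + Suc m) 0 y)"

text \<open>The edge \<open>(j, j + 1)\<close> of an \<open>n\<close>-simplex \<open>y\<close>, where \<open>j < n\<close>.\<close>

definition edge :: "'y delta \<Rightarrow> nat \<Rightarrow> nat \<Rightarrow> 'y \<Rightarrow> 'y" where
  "edge Y n j y = back_face Y 1 j (front_face Y (j + 1) (n - (j + 1)) y)"

text \<open>
  The operations \<open>dcup1\<close> and \<open>circ\<close> are forced on the span of the cup products by
  \<open>(a \<union> b)(\<sigma>) = a(01) b(12)\<close>: one has \<open>(a \<union> (b \<union>\<^sub>1 c) + (a \<union>\<^sub>1 c) \<union> b)(\<sigma>) = (a \<union> b)(\<sigma>) (c(01) + c(12))\<close>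
  and \<open>((a \<union>\<^sub>1 a') \<union> (b \<union>\<^sub>1 b'))(\<sigma>) = (a \<union> b)(\<sigma>) (a' \<union> b')(\<sigma>)\<close>.
\<close>

definition cochains :: "'y delta \<Rightarrow> ('r::comm_ring_1, 'y \<Rightarrow> 'r) cup1_dga" where
  "cochains Y =
     \<lparr>comp = (\<lambda>n.
        \<lparr>carrier = simplices Y n \<rightarrow>\<^sub>E UNIV,
         monoid.mult = undefined,
         one = undefined,
         ring.zero = (\<lambda>y\<in>simplices Y n. 0),
         ring.add = (\<lambda>u v. \<lambda>y\<in>simplices Y n. u y + v y),
         module.smult = (\<lambda>r u. \<lambda>y\<in>simplices Y n. r * u y)\<rparr>),
      unit = (\<lambda>y\<in>simplices Y 0. 1),
      cup = (\<lambda>i j u v. \<lambda>y\<in>simplices Y (i + j). u (front_face Y i j y) * v (back_face Y j i y)),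
      cup1 = (\<lambda>u v. \<lambda>e\<in>simplices Y 1. u e * v e),
      dcup1 = (\<lambda>w c. \<lambda>y\<in>simplices Y 2. w y * (c (front_face Y 1 1 y) + c (back_face Y 1 1 y))),
      circ = (\<lambda>w w'. \<lambda>y\<in>simplices Y 2. w y * w' y),
      diff = (\<lambda>n u. \<lambda>y\<in>simplices Y (Suc n). \<Sum>i\<le>Suc n. (-1) ^ i * u (face Y (Suc n) i y))\<rparr>"

definition pullback ::
  "'y delta \<Rightarrow> 'z delta \<Rightarrow> (nat \<Rightarrow> 'y \<Rightarrow> 'z) \<Rightarrow> nat \<Rightarrow> ('z \<Rightarrow> 'r) \<Rightarrow> 'y \<Rightarrow> 'r" where
  "pullback Y Z t = (\<lambda>n. \<lambda>u\<in>simplices Z n \<rightarrow>\<^sub>E UNIV. \<lambda>y\<in>simplices Y n. u (t n y))"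

text \<open>\<open>BH\<close>: the \<open>n\<close>-simplex \<open>[h\<^sub>1|\<dots>|h\<^sub>n]\<close> is a list of length \<open>n\<close>.\<close>

definition bar :: "('h, 's) monoid_scheme \<Rightarrow> 'h list delta" where
  "bar H =
     \<lparr>simplices = (\<lambda>n. {s. length s = n \<and> set s \<subseteq> carrier H}),
      face = (\<lambda>n i s.
        if i = 0 then tl s
        else if i = n then butlast s
        else take (i - 1) s @ (s ! (i - 1) \<otimes>\<^bsub>H\<^esub> s ! i) # drop (i + 1) s)\<rparr>"

definition bar_map :: "('g, 's) monoid_scheme \<Rightarrow> ('g \<Rightarrow> 'h) \<Rightarrow> nat \<Rightarrow> 'g list \<Rightarrow> 'h list" where
  "bar_map G h = (\<lambda>n. \<lambda>s\<in>simplices (bar G) n. map h s)"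


section \<open>The rings whose augmentation ideals are the free degree-one parts\<close>

text \<open>
  Polynomials with coefficients in \<open>'k\<close> and variables in \<open>'x\<close> are finitely supported functions
  on monomials, \<open>('x \<Rightarrow>\<^sub>0 nat) \<Rightarrow>\<^sub>0 'k\<close>.
\<close>

definition poly_vars_in :: "'x set \<Rightarrow> (('x \<Rightarrow>\<^sub>0 nat) \<Rightarrow>\<^sub>0 'k::zero) \<Rightarrow> bool" where
  "poly_vars_in X q \<longleftrightarrow> (\<forall>m\<in>Poly_Mapping.keys q. Poly_Mapping.keys m \<subseteq> X)"

definition poly_eval :: "('x \<Rightarrow> 'k::comm_ring_1) \<Rightarrow> (('x \<Rightarrow>\<^sub>0 nat) \<Rightarrow>\<^sub>0 'k) \<Rightarrow> 'k" where
  "poly_eval a q = (\<Sum>m\<in>Poly_Mapping.keys q. Poly_Mapping.lookup q m * (\<Prod>x\<in>Poly_Mapping.keys m. a x ^ Poly_Mapping.lookup m x))"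

definition poly_const :: "'k \<Rightarrow> (('x \<Rightarrow>\<^sub>0 nat) \<Rightarrow>\<^sub>0 'k::zero)" where
  "poly_const c = Poly_Mapping.single 0 c"

definition poly_var :: "'x \<Rightarrow> (('x \<Rightarrow>\<^sub>0 nat) \<Rightarrow>\<^sub>0 'k::zero_neq_one)" where
  "poly_var x = Poly_Mapping.single (Poly_Mapping.single x 1) 1"

text \<open>
  An \<open>R\<close>-algebra of (classes of) polynomials in the variables \<open>vars P\<close>, with its ideal
  \<open>ideal0 P\<close> of elements with zero constant term, which is \<open>\<T>\<^sup>1\<^sub>R(vars P)\<close>.
\<close>

record ('r, 'q, 'x) poly_alg = "('r, 'q) module" +
  vars   :: "'x set"
  ideal0 :: "'q set"
  var    :: "'x \<Rightarrow> 'q"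
  evl    :: "'q \<Rightarrow> ('x \<Rightarrow> 'r) \<Rightarrow> 'r"

definition int_valued_polys :: "'x set \<Rightarrow> (('x \<Rightarrow>\<^sub>0 nat) \<Rightarrow>\<^sub>0 rat) set" where
  "int_valued_polys X = {q. poly_vars_in X q \<and> (\<forall>a :: 'x \<Rightarrow> int. poly_eval (\<lambda>x. of_int (a x)) q \<in> \<int>)}"

definition int_valued :: "'x set \<Rightarrow> (int, ('x \<Rightarrow>\<^sub>0 nat) \<Rightarrow>\<^sub>0 rat, 'x) poly_alg" where
  "int_valued X =
     \<lparr>carrier = int_valued_polys X, monoid.mult = (*), one = 1, ring.zero = 0, ring.add = (+),
      module.smult = (\<lambda>r q. poly_const (of_int r) * q),
      vars = X,
      ideal0 = {q \<in> int_valued_polys X. Poly_Mapping.lookup q 0 = 0},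
      var = poly_var,
      evl = (\<lambda>q a. \<lfloor>poly_eval (\<lambda>x. of_int (a x)) q\<rfloor>)\<rparr>"

definition poly_ring :: "'x set \<Rightarrow> (('x \<Rightarrow>\<^sub>0 nat) \<Rightarrow>\<^sub>0 'k::comm_ring_1) ring" where
  "poly_ring X = \<lparr>carrier = {q. poly_vars_in X q}, monoid.mult = (*), one = 1, ring.zero = 0, ring.add = (+)\<rparr>"

definition fermat_ideal :: "'x set \<Rightarrow> (('x \<Rightarrow>\<^sub>0 nat) \<Rightarrow>\<^sub>0 'p::prime_card mod_ring) set" where
  "fermat_ideal X = Idl\<^bsub>poly_ring X\<^esub> ((\<lambda>x. poly_var x ^ CARD('p) - poly_var x) ` X)"

text \<open>
  The constant term and the values of a class do not depend on the representative, since
  \<open>x\<^sup>p - x\<close> has zero constant term and vanishes on \<open>\<F>\<^sub>p\<close>.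
\<close>

definition mod_p_polys ::
  "'x set \<Rightarrow> ('p::prime_card mod_ring, (('x \<Rightarrow>\<^sub>0 nat) \<Rightarrow>\<^sub>0 'p mod_ring) set, 'x) poly_alg" where
  "mod_p_polys X =
     (let Q = poly_ring X Quot fermat_ideal X;
          cls = (\<lambda>q. fermat_ideal X +>\<^bsub>poly_ring X\<^esub> q)
      in \<lparr>carrier = carrier Q, monoid.mult = monoid.mult Q, one = one Q, ring.zero = ring.zero Q, ring.add = ring.add Q,
          module.smult = (\<lambda>r C. cls (poly_const r) \<otimes>\<^bsub>Q\<^esub> C),
          vars = X,
          ideal0 = {C \<in> carrier Q. \<forall>q\<in>C. Poly_Mapping.lookup q 0 = 0},
          var = (\<lambda>x. cls (poly_var x)),
          evl = (\<lambda>C a. THE v. \<forall>q\<in>C. poly_eval a q = v)\<rparr>)"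


section \<open>Tensor algebras and free objects\<close>

text \<open>
  The degree \<open>n\<close> part of the tensor algebra of \<open>V = ideal0 P\<close> is the free \<open>R\<close>-module on the
  words of length \<open>n\<close> in \<open>V\<close>, modulo the multilinearity relations.  Its elements are cosets.
\<close>

type_synonym ('r, 'q) tensor = "('q list \<Rightarrow>\<^sub>0 'r) set"

definition word :: "'q list \<Rightarrow> 'q list \<Rightarrow>\<^sub>0 'r::comm_ring_1" where
  "word w = Poly_Mapping.single w 1"

definition scale :: "'r \<Rightarrow> ('w \<Rightarrow>\<^sub>0 'r) \<Rightarrow> ('w \<Rightarrow>\<^sub>0 'r::comm_ring_1)" where
  "scale r = Poly_Mapping.map ((*) r)"

definition free_words :: "('r::comm_ring_1, 'q, 'x, 's) poly_alg_scheme \<Rightarrow> nat \<Rightarrow> ('q list \<Rightarrow>\<^sub>0 'r) set" where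
  "free_words P n = {u. \<forall>w\<in>Poly_Mapping.keys u. length w = n \<and> set w \<subseteq> ideal0 P}"

inductive_set tensor_rels :: "('r::comm_ring_1, 'q, 'x, 's) poly_alg_scheme \<Rightarrow> nat \<Rightarrow> ('q list \<Rightarrow>\<^sub>0 'r) set"
  for P :: "('r::comm_ring_1, 'q, 'x, 's) poly_alg_scheme" and n :: nat where
  zero: "0 \<in> tensor_rels P n"
| additive: "\<lbrakk>set w \<subseteq> ideal0 P; set w' \<subseteq> ideal0 P; a \<in> ideal0 P; b \<in> ideal0 P; length w + 1 + length w' = n\<rbrakk>
    \<Longrightarrow> word (w @ [a \<oplus>\<^bsub>P\<^esub> b] @ w') - word (w @ [a] @ w') - word (w @ [b] @ w') \<in> tensor_rels P n"
| homogeneous: "\<lbrakk>set w \<subseteq> ideal0 P; set w' \<subseteq> ideal0 P; a \<in> ideal0 P; length w + 1 + length w' = n\<rbrakk>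
    \<Longrightarrow> word (w @ [r \<odot>\<^bsub>P\<^esub> a] @ w') - scale r (word (w @ [a] @ w')) \<in> tensor_rels P n"
| add: "u \<in> tensor_rels P n \<Longrightarrow> v \<in> tensor_rels P n \<Longrightarrow> u + v \<in> tensor_rels P n"
| scale: "u \<in> tensor_rels P n \<Longrightarrow> scale r u \<in> tensor_rels P n"

definition tensor_class ::
  "('r::comm_ring_1, 'q, 'x, 's) poly_alg_scheme \<Rightarrow> nat \<Rightarrow> ('q list \<Rightarrow>\<^sub>0 'r) \<Rightarrow> ('r, 'q) tensor" where
  "tensor_class P n u = {v. v - u \<in> tensor_rels P n}"

text \<open>
  The map of tensors in degrees \<open>i\<close> and \<open>j\<close> to tensors in degree \<open>k\<close> induced by the bilinear
  extension of a map \<open>f\<close> on words.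
\<close>

definition bilinear_extension ::
  "('q list \<Rightarrow> 'q list \<Rightarrow> ('q list \<Rightarrow>\<^sub>0 'r)) \<Rightarrow> ('q list \<Rightarrow>\<^sub>0 'r) \<Rightarrow> ('q list \<Rightarrow>\<^sub>0 'r) \<Rightarrow> ('q list \<Rightarrow>\<^sub>0 'r::comm_ring_1)" where
  "bilinear_extension f u v = (\<Sum>w\<in>Poly_Mapping.keys u. \<Sum>z\<in>Poly_Mapping.keys v. scale (Poly_Mapping.lookup u w * Poly_Mapping.lookup v z) (f w z))"

definition tensor_op ::
  "('r::comm_ring_1, 'q, 'x, 's) poly_alg_scheme \<Rightarrow> nat \<Rightarrow> ('q list \<Rightarrow> 'q list \<Rightarrow> ('q list \<Rightarrow>\<^sub>0 'r)) \<Rightarrow>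
   ('r, 'q) tensor \<Rightarrow> ('r, 'q) tensor \<Rightarrow> ('r, 'q) tensor" where
  "tensor_op P k f U V = (\<Union>u\<in>U. \<Union>v\<in>V. tensor_class P k (bilinear_extension f u v))"

text \<open>
  \<open>\<T>\<^sub>R(X)\<close> with a map \<open>d\<close> as differential, where \<open>P\<close> is \<open>int_valued X\<close> or \<open>mod_p_polys X\<close>.
  Here every tensor of degree 2 is decomposable, and
  \<open>(a \<otimes> b) \<union>\<^sub>1 c = a \<otimes> bc + ac \<otimes> b\<close> and \<open>(a \<otimes> b) \<circ> (a' \<otimes> b') = aa' \<otimes> bb'\<close>.
\<close>

definition free_dga ::
  "('r::comm_ring_1, 'q, 'x, 's) poly_alg_scheme \<Rightarrow> (nat \<Rightarrow> ('r, 'q) tensor \<Rightarrow> ('r, 'q) tensor) \<Rightarrow>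
   ('r, ('r, 'q) tensor) cup1_dga" where
  "free_dga P d =
     \<lparr>comp = (\<lambda>n.
        \<lparr>carrier = tensor_class P n ` free_words P n,
         monoid.mult = undefined,
         one = undefined,
         ring.zero = tensor_class P n 0,
         ring.add = (\<lambda>U V. \<Union>u\<in>U. \<Union>v\<in>V. tensor_class P n (u + v)),
         module.smult = (\<lambda>r U. \<Union>u\<in>U. tensor_class P n (scale r u))\<rparr>),
      unit = tensor_class P 0 (word []),
      cup = (\<lambda>i j. tensor_op P (i + j) (\<lambda>w z. word (w @ z))),
      cup1 = tensor_op P 1 (\<lambda>w z. word [w ! 0 \<otimes>\<^bsub>P\<^esub> z ! 0]),
      dcup1 = tensor_op P 2
        (\<lambda>w z. word [w ! 0, w ! 1 \<otimes>\<^bsub>P\<^esub> z ! 0] + word [w ! 0 \<otimes>\<^bsub>P\<^esub> z ! 0, w ! 1]),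
      circ = tensor_op P 2 (\<lambda>w z. word [w ! 0 \<otimes>\<^bsub>P\<^esub> z ! 0, w ! 1 \<otimes>\<^bsub>P\<^esub> z ! 1]),
      diff = d\<rparr>"

definition gen :: "('r::comm_ring_1, 'q, 'x, 's) poly_alg_scheme \<Rightarrow> 'x \<Rightarrow> ('r, 'q) tensor" where
  "gen P x = tensor_class P 1 (word [var P x])"

text \<open>
  \<open>tensor_eval P [a\<^sub>1, \<dots>, a\<^sub>n]\<close> sends \<open>\<Sum>\<^sub>i p\<^sub>i\<^sub>1 \<otimes> \<dots> \<otimes> p\<^sub>i\<^sub>n\<close> to \<open>\<Sum>\<^sub>i p\<^sub>i\<^sub>1(a\<^sub>1) \<cdots> p\<^sub>i\<^sub>n(a\<^sub>n)\<close>.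
\<close>

definition tensor_eval ::
  "('r::comm_ring_1, 'q, 'x, 's) poly_alg_scheme \<Rightarrow> ('x \<Rightarrow> 'r) list \<Rightarrow> ('r, 'q) tensor \<Rightarrow> 'r" where
  "tensor_eval P as U =
     (THE v. \<forall>u\<in>U. (\<Sum>w\<in>Poly_Mapping.keys u. Poly_Mapping.lookup u w * prod_list (map2 (evl P) w as)) = v)"


section \<open>Colimits of Hirsch extensions\<close>

text \<open>
  In this section \<open>F\<close> is \<^const>\<open>int_valued\<close> or \<^const>\<open>mod_p_polys\<close>.  A morphism that is the identity on
  variables is the canonical inclusion, because \<open>\<T>\<^sub>R(X)\<close> is free on \<open>X\<close>.
\<close>

definition is_inclusion ::
  "('x set \<Rightarrow> ('r::comm_ring_1, 'q, 'x) poly_alg) \<Rightarrow> 'x set \<Rightarrow> (nat \<Rightarrow> ('r, 'q) tensor \<Rightarrow> ('r, 'q) tensor) \<Rightarrow>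
   'x set \<Rightarrow> (nat \<Rightarrow> ('r, 'q) tensor \<Rightarrow> ('r, 'q) tensor) \<Rightarrow> (nat \<Rightarrow> ('r, 'q) tensor \<Rightarrow> ('r, 'q) tensor) \<Rightarrow> bool" where
  "is_inclusion F X d X' d' \<iota> \<longleftrightarrow>
     \<iota> \<in> dga_hom (free_dga (F X) d) (free_dga (F X') d') \<and> (\<forall>x\<in>X. \<iota> 1 (gen (F X) x) = gen (F X') x)"

definition hirsch_extension ::
  "('x set \<Rightarrow> ('r::comm_ring_1, 'q, 'x) poly_alg) \<Rightarrow> 'x set \<Rightarrow> (nat \<Rightarrow> ('r, 'q) tensor \<Rightarrow> ('r, 'q) tensor) \<Rightarrow>
   'x set \<Rightarrow> (nat \<Rightarrow> ('r, 'q) tensor \<Rightarrow> ('r, 'q) tensor) \<Rightarrow> bool" where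
  "hirsch_extension F X d Y d' \<longleftrightarrow>
     X \<inter> Y = {} \<and>
     binomial_cup1_dga (free_dga (F X) d) \<and>
     binomial_cup1_dga (free_dga (F (X \<union> Y)) d') \<and>
     (\<exists>\<iota>. is_inclusion F X d (X \<union> Y) d' \<iota> \<and>
        (\<forall>y\<in>Y. \<exists>z\<in>comps (free_dga (F X) d) 2.
           d 2 z = \<zero>\<^bsub>comp (free_dga (F X) d) 3\<^esub> \<and> d' 1 (gen (F (X \<union> Y)) y) = \<iota> 2 z))"

text \<open>\<open>Xs n\<close> is the set \<open>X\<^sub>n\<^sub>+\<^sub>1\<close> and \<open>ds n\<close> is the differential of \<open>\<M>\<^sub>n\<^sub>+\<^sub>1\<close>.\<close>

definition hirsch_colimit ::
  "('x set \<Rightarrow> ('r::comm_ring_1, 'q, 'x) poly_alg) \<Rightarrow> 'x set \<Rightarrow> (nat \<Rightarrow> ('r, 'q) tensor \<Rightarrow> ('r, 'q) tensor) \<Rightarrow> bool" where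
  "hirsch_colimit F X d \<longleftrightarrow>
     (\<exists>Xs ds.
        X = (\<Union>n. Xs n) \<and>
        binomial_cup1_dga (free_dga (F (Xs 0)) (ds 0)) \<and>
        (\<forall>x\<in>Xs 0. ds 0 1 (gen (F (Xs 0)) x) = \<zero>\<^bsub>comp (free_dga (F (Xs 0)) (ds 0)) 2\<^esub>) \<and>
        (\<forall>n. hirsch_extension F (\<Union>i\<le>n. Xs i) (ds n) (Xs (Suc n)) (ds (Suc n))) \<and>
        binomial_cup1_dga (free_dga (F X) d) \<and>
        (\<forall>n. \<exists>\<iota>. is_inclusion F (\<Union>i\<le>n. Xs i) (ds n) X d \<iota>))"


section \<open>The group of a colimit of Hirsch extensions and the correspondence\<close>

text \<open>The zero function is neutral because the elements of \<open>ideal0 P\<close> vanish at it.\<close>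

definition hirsch_group ::
  "('r::comm_ring_1, 'q, 'x, 's) poly_alg_scheme \<Rightarrow> (nat \<Rightarrow> ('r, 'q) tensor \<Rightarrow> ('r, 'q) tensor) \<Rightarrow>
   ('x \<Rightarrow> 'r) monoid" where
  "hirsch_group P d =
     \<lparr>carrier = vars P \<rightarrow>\<^sub>E UNIV,
      monoid.mult = (\<lambda>a b. \<lambda>x\<in>vars P. a x + b x - tensor_eval P [a, b] (d 1 (gen P x))),
      one = (\<lambda>x\<in>vars P. 0)\<rparr>"

text \<open>The homomorphism induced by \<open>\<alpha> : free_dga P d \<rightarrow> free_dga P' d'\<close>.\<close>

definition induced_hom ::
  "('r::comm_ring_1, 'q, 'x, 's) poly_alg_scheme \<Rightarrow> ('r, 'q', 'x', 's') poly_alg_scheme \<Rightarrow>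
   (nat \<Rightarrow> ('r, 'q) tensor \<Rightarrow> ('r, 'q') tensor) \<Rightarrow> ('x' \<Rightarrow> 'r) \<Rightarrow> 'x \<Rightarrow> 'r" where
  "induced_hom P P' \<alpha> = (\<lambda>a\<in>vars P' \<rightarrow>\<^sub>E UNIV. \<lambda>x\<in>vars P. tensor_eval P' [a] (\<alpha> 1 (gen P x)))"

definition is_canonical_morphism ::
  "('r::comm_ring_1, 'q, 'x, 's) poly_alg_scheme \<Rightarrow> (nat \<Rightarrow> ('r, 'q) tensor \<Rightarrow> ('r, 'q) tensor) \<Rightarrow>
   (nat \<Rightarrow> ('r, 'q) tensor \<Rightarrow> ('x \<Rightarrow> 'r) list \<Rightarrow> 'r) \<Rightarrow> bool" where
  "is_canonical_morphism P d \<psi> \<longleftrightarrow>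
     \<psi> \<in> dga_hom (free_dga P d) (cochains (bar (hirsch_group P d))) \<and>
     (\<forall>x\<in>vars P. \<forall>a\<in>carrier (hirsch_group P d). \<psi> 1 (gen P x) [a] = a x)"

text \<open>The map \<open>r\<close>; the vertices of \<open>Y\<close> go to the vertex \<open>[]\<close>.\<close>

definition to_delta_map ::
  "('r::comm_ring_1, 'q, 'x, 's) poly_alg_scheme \<Rightarrow> 'y delta \<Rightarrow> (nat \<Rightarrow> ('r, 'q) tensor \<Rightarrow> 'y \<Rightarrow> 'r) \<Rightarrow>
   nat \<Rightarrow> 'y \<Rightarrow> ('x \<Rightarrow> 'r) list" where
  "to_delta_map P Y f =
     (\<lambda>n. \<lambda>y\<in>simplices Y n. map (\<lambda>j. \<lambda>x\<in>vars P. f 1 (gen P x) (edge Y n j y)) [0..<n])"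

end

theory Submission
  imports Defs
begin

text \<open>
  Evaluating tensors turns every clause into an identity between values.  A linear and
  multiplicative functional on \<open>\<T>\<^sup>1\<^sub>R(X)\<close> is the evaluation at the function of its values on the variables:
  this is immediate for polynomials over \<open>\<F>\<^sub>p\<close>, and for integer-valued polynomials one clears
  denominators and uses that \<open>\<int>\<close> is torsion-free (\<open>functional_eq_evl\<close>).  If \<open>f\<close> is a morphism from
  \<open>\<M>\<close> to the cochains of \<open>Y\<close>, this applies to \<open>u \<mapsto> f(u)(e)\<close> for each edge \<open>e\<close>, and compatibility with cup products gives
  \<open>f(p\<^sub>1 \<otimes> \<dots> \<otimes> p\<^sub>n)(y) = p\<^sub>1(a\<^sub>1) \<cdots> p\<^sub>n(a\<^sub>n)\<close>, where \<open>[a\<^sub>1|\<dots>|a\<^sub>n] = r(f)(y)\<close> (\<open>hom_eq_E\<close>).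
  Hence \<open>f\<close> is determined by \<open>r(f)\<close> and factors through the canonical morphism, which is the morphism with \<open>r = id\<close>.

  On a triangle, \<open>f(dx) = d(f(x))\<close> says that the label of the long edge is the product in \<open>G(\<M>)\<close> of the
  labels of the two short ones (\<open>edge_label_triangle\<close>), so \<open>r(f)\<close> commutes with faces.

  Conversely, a map \<open>t\<close> to \<open>BG(\<M>)\<close> defines \<open>f\<close> by evaluation, \<open>f(u)(y) = u(t(y))\<close>.  It clearly respects the
  products, and the point is that it commutes with differentials.  Now
  \<open>(dp)(a, b) = p(a) + p(b) - p(a \<cdot> b)\<close> holds for variables \<open>p\<close> by the definition of \<open>a \<cdot> b\<close>; by the formula for
  \<open>d(p \<union>\<^sub>1 q)\<close> it is inherited by products, and by torsion-freeness by quotients, hence it holds for all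
  \<open>p\<close> in \<open>\<T>\<^sup>1\<^sub>R(X)\<close> (\<open>E_d_degree_one\<close>).  The Leibniz rule then shows that evaluation turns \<open>d\<close> into the
  alternating sum of the faces of the bar construction in all degrees (\<open>E_d\<close>).
\<close>

section \<open>Linear functionals on free modules\<close>

text \<open>The linear extension to finitely supported functions of a map \<open>g\<close> on the basis.\<close>

definition linear_extension :: "('w \<Rightarrow> 'r) \<Rightarrow> ('w \<Rightarrow>\<^sub>0 'r) \<Rightarrow> 'r::comm_ring_1" where
  "linear_extension g u = (\<Sum>w\<in>Poly_Mapping.keys u. Poly_Mapping.lookup u w * g w)"

lemma linear_extension_superset:
  assumes "finite A" "Poly_Mapping.keys u \<subseteq> A"
  shows "linear_extension g u = (\<Sum>w\<in>A. Poly_Mapping.lookup u w * g w)"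
  unfolding linear_extension_def
  using assms by (intro sum.mono_neutral_left) (auto simp: in_keys_iff)

lemma linear_extension_zero [simp]: "linear_extension g 0 = 0"
  by (simp add: linear_extension_def)

lemma linear_extension_single [simp]: "linear_extension g (Poly_Mapping.single w c) = c * g w"
  by (simp add: linear_extension_def)

lemma linear_extension_add [simp]:
  "linear_extension g (u + v) = linear_extension g u + linear_extension g v"
proof -
  let ?A = "Poly_Mapping.keys u \<union> Poly_Mapping.keys v"
  have "Poly_Mapping.keys (u + v) \<subseteq> ?A"
    by (rule keys_add)
  then have "linear_extension g (u + v) = (\<Sum>w\<in>?A. Poly_Mapping.lookup (u + v) w * g w)"
    by (intro linear_extension_superset) auto
  also have "\<dots> = (\<Sum>w\<in>?A. Poly_Mapping.lookup u w * g w) + (\<Sum>w\<in>?A. Poly_Mapping.lookup v w * g w)"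
    by (simp add: lookup_add distrib_right sum.distrib)
  also have "\<dots> = linear_extension g u + linear_extension g v"
    by (simp add: linear_extension_superset[of ?A])
  finally show ?thesis .
qed

lemma lookup_scale [simp]:
  "Poly_Mapping.lookup (scale r u) w = r * Poly_Mapping.lookup u w"
  by (simp add: scale_def Poly_Mapping.map.rep_eq when_def)

lemma keys_scale: "Poly_Mapping.keys (scale r u) \<subseteq> Poly_Mapping.keys u"
  by (auto simp: in_keys_iff)

lemma linear_extension_scale [simp]:
  "linear_extension g (scale r u) = r * linear_extension g u"
proof -
  have "linear_extension g (scale r u)
      = (\<Sum>w\<in>Poly_Mapping.keys u. Poly_Mapping.lookup (scale r u) w * g w)"
    by (intro linear_extension_superset keys_scale) auto
  then show ?thesis
    by (simp add: linear_extension_def sum_distrib_left mult.assoc)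
qed

lemma scale_zero: "scale 0 u = 0"
  by (rule poly_mapping_eqI) simp

lemma scale_minus_one: "scale (- 1) u = - u"
  by (rule poly_mapping_eqI) simp

lemma linear_extension_minus [simp]:
  "linear_extension g (- u) = - linear_extension g u"
  by (metis linear_extension_scale mult_minus1 scale_minus_one)

lemma linear_extension_diff [simp]:
  "linear_extension g (u - v) = linear_extension g u - linear_extension g v"
  using linear_extension_add[of g u "- v"] by simp

lemma linear_extension_sum [simp]:
  "linear_extension g (sum h A) = (\<Sum>i\<in>A. linear_extension g (h i))"
  by (induction A rule: infinite_finite_induct) auto

lemma poly_mapping_sum_single:
  "u = (\<Sum>w\<in>Poly_Mapping.keys u. Poly_Mapping.single w (Poly_Mapping.lookup u w))"
  by (rule poly_mapping_eqI)
    (auto simp: lookup_sum lookup_single when_def in_keys_iff)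

lemma poly_mapping_induct_on_keys:
  fixes u :: "'w \<Rightarrow>\<^sub>0 'r::comm_monoid_add"
  assumes "S 0"
    and "\<And>w. w \<in> Poly_Mapping.keys u \<Longrightarrow> S (Poly_Mapping.single w (Poly_Mapping.lookup u w))"
    and "\<And>u v. S u \<Longrightarrow> S v \<Longrightarrow> S (u + v)"
  shows "S u"
proof -
  have "S (sum h A)" if "finite A" "\<forall>i\<in>A. S (h i)" for h and A :: "'w set"
    using that by (induction A rule: finite_induct) (auto intro: assms)
  then show ?thesis
    by (subst poly_mapping_sum_single) (use assms(2) in auto)
qed

text \<open>
  A multiplicative map on the monoid of basis elements extends to a ring homomorphism of the
  monoid algebra.
\<close>

lemma linear_extension_mult:
  assumes "\<And>k l. g (k + l) = g k * g l"
  shows "linear_extension g (u * v) = linear_extension g u * linear_extension g v"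
proof -
  let ?s = "\<lambda>u k. Poly_Mapping.single k (Poly_Mapping.lookup u k)"
  have "u * v = (\<Sum>k\<in>Poly_Mapping.keys u. ?s u k) * (\<Sum>l\<in>Poly_Mapping.keys v. ?s v l)"
    using poly_mapping_sum_single[of u] poly_mapping_sum_single[of v] by simp
  also have "\<dots> = (\<Sum>k\<in>Poly_Mapping.keys u. \<Sum>l\<in>Poly_Mapping.keys v.
      Poly_Mapping.single (k + l) (Poly_Mapping.lookup u k * Poly_Mapping.lookup v l))"
    by (simp add: sum_product mult_single)
  finally have "linear_extension g (u * v) = (\<Sum>k\<in>Poly_Mapping.keys u. \<Sum>l\<in>Poly_Mapping.keys v.
      (Poly_Mapping.lookup u k * Poly_Mapping.lookup v l) * g (k + l))"
    by simp
  then show ?thesis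
    by (simp add: linear_extension_def sum_product assms mult_ac)
qed

lemma linear_extension_bilinear:
  assumes "\<And>w z. w \<in> Poly_Mapping.keys u \<Longrightarrow> z \<in> Poly_Mapping.keys v \<Longrightarrow>
    linear_extension g (f w z) = h w * k z"
  shows "linear_extension g (bilinear_extension f u v) = linear_extension h u * linear_extension k v"
proof -
  have "linear_extension g (bilinear_extension f u v)
      = (\<Sum>w\<in>Poly_Mapping.keys u. \<Sum>z\<in>Poly_Mapping.keys v.
          (Poly_Mapping.lookup u w * Poly_Mapping.lookup v z) * (h w * k z))"
    by (simp add: bilinear_extension_def assms)
  then show ?thesis
    by (simp add: linear_extension_def sum_product mult_ac)
qed


section \<open>Evaluation algebras\<close>

text \<open>
  The properties of \<open>\<T>\<^sup>1\<^sub>R(X)\<close>, \<open>R\<close> a domain, on which the correspondence rests: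
  it is closed under the operations, evaluation at a function is linear and multiplicative, and
  the only subset that contains \<open>0\<close> and the variables and is closed under the operations and
  under division by nonzero scalars is \<open>\<T>\<^sup>1\<^sub>R(X)\<close> itself.  Division is needed
  because a binomial coefficient is only a rational combination of monomials.
\<close>

locale evaluation_algebra =
  fixes P :: "('r::idom, 'q, 'x) poly_alg"
  assumes zero_closed [simp]: "\<zero>\<^bsub>P\<^esub> \<in> ideal0 P"
    and add_closed [simp]: "p \<in> ideal0 P \<Longrightarrow> q \<in> ideal0 P \<Longrightarrow> p \<oplus>\<^bsub>P\<^esub> q \<in> ideal0 P"
    and mult_closed [simp]: "p \<in> ideal0 P \<Longrightarrow> q \<in> ideal0 P \<Longrightarrow> p \<otimes>\<^bsub>P\<^esub> q \<in> ideal0 P"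
    and smult_closed [simp]: "p \<in> ideal0 P \<Longrightarrow> r \<odot>\<^bsub>P\<^esub> p \<in> ideal0 P"
    and var_closed [simp]: "x \<in> vars P \<Longrightarrow> var P x \<in> ideal0 P"
    and zero_smult: "p \<in> ideal0 P \<Longrightarrow> 0 \<odot>\<^bsub>P\<^esub> p = \<zero>\<^bsub>P\<^esub>"
    and evl_add [simp]: "p \<in> ideal0 P \<Longrightarrow> q \<in> ideal0 P \<Longrightarrow> evl P (p \<oplus>\<^bsub>P\<^esub> q) a = evl P p a + evl P q a"
    and evl_mult [simp]: "p \<in> ideal0 P \<Longrightarrow> q \<in> ideal0 P \<Longrightarrow> evl P (p \<otimes>\<^bsub>P\<^esub> q) a = evl P p a * evl P q a"
    and evl_smult [simp]: "p \<in> ideal0 P \<Longrightarrow> evl P (r \<odot>\<^bsub>P\<^esub> p) a = r * evl P p a"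
    and evl_var [simp]: "x \<in> vars P \<Longrightarrow> evl P (var P x) a = a x"
    and ideal0_induct [consumes 1, case_names zero var add mult smult divide]:
      "\<lbrakk>q \<in> ideal0 P;
        S \<zero>\<^bsub>P\<^esub>;
        \<And>x. x \<in> vars P \<Longrightarrow> S (var P x);
        \<And>p q. p \<in> ideal0 P \<Longrightarrow> q \<in> ideal0 P \<Longrightarrow> S p \<Longrightarrow> S q \<Longrightarrow> S (p \<oplus>\<^bsub>P\<^esub> q);
        \<And>p q. p \<in> ideal0 P \<Longrightarrow> q \<in> ideal0 P \<Longrightarrow> S p \<Longrightarrow> S q \<Longrightarrow> S (p \<otimes>\<^bsub>P\<^esub> q);
        \<And>r p. p \<in> ideal0 P \<Longrightarrow> S p \<Longrightarrow> S (r \<odot>\<^bsub>P\<^esub> p);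
        \<And>r p. r \<noteq> 0 \<Longrightarrow> p \<in> ideal0 P \<Longrightarrow> S (r \<odot>\<^bsub>P\<^esub> p) \<Longrightarrow> S p\<rbrakk> \<Longrightarrow> S q"
begin

lemma evl_zero [simp]: "evl P \<zero>\<^bsub>P\<^esub> a = 0"
  using evl_smult[of "\<zero>\<^bsub>P\<^esub>" 0 a] by (simp add: zero_smult)

text \<open>A linear and multiplicative functional is the evaluation at its values on the variables.\<close>

lemma functional_eq_evl:
  assumes add: "\<And>p q. p \<in> ideal0 P \<Longrightarrow> q \<in> ideal0 P \<Longrightarrow> \<phi> (p \<oplus>\<^bsub>P\<^esub> q) = \<phi> p + \<phi> q"
    and mult: "\<And>p q. p \<in> ideal0 P \<Longrightarrow> q \<in> ideal0 P \<Longrightarrow> \<phi> (p \<otimes>\<^bsub>P\<^esub> q) = \<phi> p * \<phi> q"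
    and smult: "\<And>r p. p \<in> ideal0 P \<Longrightarrow> \<phi> (r \<odot>\<^bsub>P\<^esub> p) = r * \<phi> p"
    and var: "\<And>x. x \<in> vars P \<Longrightarrow> \<phi> (var P x) = a x"
    and q: "q \<in> ideal0 P"
  shows "\<phi> q = evl P q a"
  using q
proof (induction rule: ideal0_induct)
  case zero
  show ?case
    using smult[of "\<zero>\<^bsub>P\<^esub>" 0] by (simp add: zero_smult)
qed (auto simp: assms)


subsection \<open>Evaluation of tensors\<close>

text \<open>The value \<open>p\<^sub>1(a\<^sub>1) \<cdots> p\<^sub>n(a\<^sub>n)\<close> of the word \<open>[p\<^sub>1, \<dots>, p\<^sub>n]\<close> at \<open>[a\<^sub>1, \<dots>, a\<^sub>n]\<close>.\<close>

abbreviation word_eval :: "('x \<Rightarrow> 'r) list \<Rightarrow> 'q list \<Rightarrow> 'r" where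
  "word_eval as w \<equiv> prod_list (map2 (evl P) w as)"

abbreviation eval_words :: "('x \<Rightarrow> 'r) list \<Rightarrow> ('q list \<Rightarrow>\<^sub>0 'r) \<Rightarrow> 'r" where
  "eval_words as \<equiv> linear_extension (word_eval as)"

lemma linear_extension_word [simp]: "linear_extension g (word w) = (g w :: 'r)"
  by (simp add: word_def)

lemma word_eval_append:
  "length w = i \<Longrightarrow> i \<le> length as \<Longrightarrow>
    word_eval as (w @ z) = word_eval (take i as) w * word_eval (drop i as) z"
proof -
  assume "length w = i" "i \<le> length as"
  then have "zip (w @ z) (take i as @ drop i as) = zip w (take i as) @ zip z (drop i as)"
    by (intro zip_append) simp
  then show ?thesis
    by simp
qed

lemma word_eval_insert:
  assumes "length as = length w + 1 + length w'"
  shows "word_eval as (w @ [p] @ w') =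
    word_eval (take (length w) as) w * (evl P p (as ! length w) * word_eval (drop (length w + 1) as) w')"
proof -
  have "drop (length w) as = as ! length w # drop (length w + 1) as"
    using assms by (simp add: Cons_nth_drop_Suc)
  then show ?thesis
    using assms by (subst word_eval_append) auto
qed

lemma eval_tensor_rels:
  assumes "u \<in> tensor_rels P n" "length as = n"
  shows "eval_words as u = 0"
  using assms
proof (induction rule: tensor_rels.induct)
  case (additive w w' a b)
  then show ?case
    by (simp only: linear_extension_diff linear_extension_word word_eval_insert)
      (simp add: algebra_simps)
next
  case (homogeneous w w' a r)
  then show ?case
    by (simp only: linear_extension_diff linear_extension_scale linear_extension_word word_eval_insert)
      (simp add: algebra_simps)
qed auto

lemma free_words_zero: "0 \<in> free_words P n"
  and free_words_word: "length w = n \<Longrightarrow> set w \<subseteq> ideal0 P \<Longrightarrow> word w \<in> free_words P n"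
  and free_words_scale: "u \<in> free_words P n \<Longrightarrow> scale r u \<in> free_words P n"
  by (auto simp: free_words_def word_def dest: keys_scale[THEN subsetD])

lemma free_words_add: "u \<in> free_words P n \<Longrightarrow> v \<in> free_words P n \<Longrightarrow> u + v \<in> free_words P n"
  using keys_add[of u v] by (auto simp: free_words_def)

lemma free_words_diff: "u \<in> free_words P n \<Longrightarrow> v \<in> free_words P n \<Longrightarrow> u - v \<in> free_words P n"
  using keys_diff[of u v] by (auto simp: free_words_def)

lemma tensor_rels_free_words: "u \<in> tensor_rels P n \<Longrightarrow> u \<in> free_words P n"
proof (induction rule: tensor_rels.induct)
  case (additive w w' a b)
  then show ?case
    by (intro free_words_diff free_words_word) auto
next
  case (homogeneous w w' a r)
  then show ?case
    by (intro free_words_diff free_words_word free_words_scale) auto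
qed (auto intro: free_words_zero free_words_add free_words_scale)

lemma tensor_rels_minus: "u \<in> tensor_rels P n \<Longrightarrow> - u \<in> tensor_rels P n"
  using tensor_rels.scale[of u P n "- 1"] by (simp add: scale_minus_one)

lemma self_in_tensor_class [simp]: "u \<in> tensor_class P n u"
  by (simp add: tensor_class_def tensor_rels.zero)

lemma tensor_class_eqI:
  assumes "u \<in> tensor_class P n v"
  shows "tensor_class P n u = tensor_class P n v"
proof -
  have uv: "u - v \<in> tensor_rels P n"
    using assms by (simp add: tensor_class_def)
  then have "w - u \<in> tensor_rels P n \<longleftrightarrow> w - v \<in> tensor_rels P n" for w
    using tensor_rels.add[of "w - u" P n "u - v"]
      tensor_rels.add[of "w - v" P n "- (u - v)"] tensor_rels_minus[OF uv] by auto
  then show ?thesis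
    by (auto simp: tensor_class_def)
qed

lemma eval_tensor_class:
  "v \<in> tensor_class P n u \<Longrightarrow> length as = n \<Longrightarrow> eval_words as v = eval_words as u"
  using eval_tensor_rels[of "v - u" n as] by (simp add: tensor_class_def)

lemma tensor_evalI:
  assumes "u \<in> U" "\<And>u. u \<in> U \<Longrightarrow> eval_words as u = c"
  shows "tensor_eval P as U = c"
  unfolding tensor_eval_def linear_extension_def[symmetric]
  using assms by (intro the_equality) auto

lemma tensor_eval_class [simp]:
  "length as = n \<Longrightarrow> tensor_eval P as (tensor_class P n u) = eval_words as u"
  by (rule tensor_evalI[where u = u]) (auto intro: eval_tensor_class)

end


section \<open>Polynomials\<close>

abbreviation monom_eval :: "('x \<Rightarrow> 'k::comm_ring_1) \<Rightarrow> ('x \<Rightarrow>\<^sub>0 nat) \<Rightarrow> 'k" where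
  "monom_eval a m \<equiv> \<Prod>x\<in>Poly_Mapping.keys m. a x ^ Poly_Mapping.lookup m x"

lemma poly_eval_linear_extension: "poly_eval a q = linear_extension (monom_eval a) q"
  by (simp add: poly_eval_def linear_extension_def)

lemma monom_eval_superset:
  assumes "finite A" "Poly_Mapping.keys m \<subseteq> A"
  shows "monom_eval a m = (\<Prod>x\<in>A. a x ^ Poly_Mapping.lookup m x)"
  using assms by (intro prod.mono_neutral_left) (auto simp: in_keys_iff)

lemma monom_eval_add: "monom_eval a (m + l) = monom_eval a m * monom_eval a l"
proof -
  let ?A = "Poly_Mapping.keys m \<union> Poly_Mapping.keys l"
  have "Poly_Mapping.keys (m + l) \<subseteq> ?A"
    by (rule keys_add)
  then have "monom_eval a (m + l) = (\<Prod>x\<in>?A. a x ^ Poly_Mapping.lookup (m + l) x)"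
    by (intro monom_eval_superset) auto
  also have "\<dots> = (\<Prod>x\<in>?A. a x ^ Poly_Mapping.lookup m x) * (\<Prod>x\<in>?A. a x ^ Poly_Mapping.lookup l x)"
    by (simp add: lookup_add power_add prod.distrib)
  also have "\<dots> = monom_eval a m * monom_eval a l"
    by (simp add: monom_eval_superset[of ?A])
  finally show ?thesis .
qed

lemma poly_eval_zero [simp]: "poly_eval a 0 = 0"
  and poly_eval_add [simp]: "poly_eval a (p + q) = poly_eval a p + poly_eval a q"
  and poly_eval_diff [simp]: "poly_eval a (p - q) = poly_eval a p - poly_eval a q"
  and poly_eval_uminus [simp]: "poly_eval a (- p) = - poly_eval a p"
  and poly_eval_mult [simp]: "poly_eval a (p * q) = poly_eval a p * poly_eval a q"
  and poly_eval_const [simp]: "poly_eval a (poly_const c) = c"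
  and poly_eval_var [simp]: "poly_eval a (poly_var x) = a x"
  by (simp_all add: poly_eval_linear_extension linear_extension_mult[OF monom_eval_add]
      poly_const_def poly_var_def)

lemma poly_eval_power [simp]: "poly_eval a (p ^ n) = poly_eval a p ^ n"
  by (induction n) (simp_all add: poly_eval_const[unfolded poly_const_def, of a 1, simplified])

lemma poly_eval_at_zero: "poly_eval (\<lambda>_. 0) q = Poly_Mapping.lookup q 0"
proof -
  have "monom_eval (\<lambda>_. 0::'a) m = (if m = 0 then 1 else 0)" for m :: "'b \<Rightarrow>\<^sub>0 nat"
  proof (cases "m = 0")
    case False
    then obtain x where "x \<in> Poly_Mapping.keys m"
      by fastforce
    then have "monom_eval (\<lambda>_. 0::'a) m = 0"
      by (intro prod_zero) (auto simp: in_keys_iff zero_power)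
    with False show ?thesis
      by simp
  qed simp
  then have "poly_eval (\<lambda>_. 0) q
      = (\<Sum>m\<in>Poly_Mapping.keys q. if m = 0 then Poly_Mapping.lookup q 0 else 0)"
    unfolding poly_eval_def by (intro sum.cong) auto
  then show ?thesis
    by (auto simp: in_keys_iff)
qed

lemma lookup_mult_zero:
  "Poly_Mapping.lookup (p * q) 0 = Poly_Mapping.lookup p 0 * Poly_Mapping.lookup q 0"
  for p q :: "('x \<Rightarrow>\<^sub>0 nat) \<Rightarrow>\<^sub>0 'k::comm_ring_1"
  by (simp flip: poly_eval_at_zero)

lemma lookup_poly_var_zero [simp]:
  "Poly_Mapping.lookup (poly_var x :: ('x \<Rightarrow>\<^sub>0 nat) \<Rightarrow>\<^sub>0 'k::comm_ring_1) 0 = 0"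
  by (simp flip: poly_eval_at_zero)

lemma poly_const_mult: "poly_const c * q = scale c q"
  for q :: "('x \<Rightarrow>\<^sub>0 nat) \<Rightarrow>\<^sub>0 'k::comm_ring_1"
  by (simp add: poly_const_def scale_def mult_map_scale_conv_mult)

lemma poly_vars_in_zero: "poly_vars_in X 0"
  and poly_vars_in_const: "poly_vars_in X (poly_const c)"
  by (auto simp: poly_vars_in_def poly_const_def)

lemma poly_vars_in_one: "poly_vars_in X (1 :: ('x \<Rightarrow>\<^sub>0 nat) \<Rightarrow>\<^sub>0 'k::comm_ring_1)"
  using poly_vars_in_const[of X "1::'k"] by (simp add: poly_const_def)

lemma poly_vars_in_var:
  "x \<in> X \<Longrightarrow> poly_vars_in X (poly_var x :: ('x \<Rightarrow>\<^sub>0 nat) \<Rightarrow>\<^sub>0 'k::comm_ring_1)"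
  by (auto simp: poly_vars_in_def poly_var_def)

lemma poly_vars_in_add: "poly_vars_in X p \<Longrightarrow> poly_vars_in X q \<Longrightarrow> poly_vars_in X (p + q)"
  using keys_add[of p q] by (fastforce simp: poly_vars_in_def)

lemma poly_vars_in_uminus: "poly_vars_in X p \<Longrightarrow> poly_vars_in X (- p)"
  by (auto simp: poly_vars_in_def)

lemma poly_vars_in_diff:
  "poly_vars_in X p \<Longrightarrow> poly_vars_in X q \<Longrightarrow> poly_vars_in X (p - q)"
  for p q :: "('x \<Rightarrow>\<^sub>0 nat) \<Rightarrow>\<^sub>0 'k::comm_ring_1"
  using poly_vars_in_add[of X p "- q"] poly_vars_in_uminus[of X q] by simp

lemma poly_vars_in_mult:
  assumes "poly_vars_in X p" "poly_vars_in X q"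
  shows "poly_vars_in X (p * q)"
proof -
  have "Poly_Mapping.keys (k + l) \<subseteq> X"
    if "k \<in> Poly_Mapping.keys p" "l \<in> Poly_Mapping.keys q" for k l
    using that assms keys_add[of k l] by (fastforce simp: poly_vars_in_def)
  then show ?thesis
    using keys_mult[of p q] by (fastforce simp: poly_vars_in_def)
qed

lemma poly_vars_in_power:
  "poly_vars_in X p \<Longrightarrow> poly_vars_in X (p ^ n)"
  for p :: "('x \<Rightarrow>\<^sub>0 nat) \<Rightarrow>\<^sub>0 'k::comm_ring_1"
  by (induction n) (auto intro: poly_vars_in_one poly_vars_in_mult)

text \<open>
  The nonconstant monomials are products of variables, so a polynomial with zero constant term
  is obtained from the variables by products, sums, and multiplication by its coefficients.
\<close>

lemma poly_induct_zero_constant_term: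
  fixes q :: "('x \<Rightarrow>\<^sub>0 nat) \<Rightarrow>\<^sub>0 'k::comm_ring_1"
  assumes q: "poly_vars_in X q" "Poly_Mapping.lookup q 0 = 0"
    and zero: "S 0"
    and var: "\<And>x. x \<in> X \<Longrightarrow> S (poly_var x)"
    and add: "\<And>p q. S p \<Longrightarrow> S q \<Longrightarrow> S (p + q)"
    and mult: "\<And>p q. S p \<Longrightarrow> S q \<Longrightarrow> S (p * q)"
    and coeff: "\<And>m p. m \<in> Poly_Mapping.keys q \<Longrightarrow> S p \<Longrightarrow> S (poly_const (Poly_Mapping.lookup q m) * p)"
  shows "S q"
proof -
  let ?mon = "\<lambda>m. Poly_Mapping.single m (1::'k)"
  have power: "S (?mon (Poly_Mapping.single x (Suc n)))" if "x \<in> X" for x n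
  proof (induction n)
    case 0
    show ?case
      using var[OF that] by (simp add: poly_var_def)
  next
    case (Suc n)
    have "?mon (Poly_Mapping.single x (Suc (Suc n)))
        = poly_var x * ?mon (Poly_Mapping.single x (Suc n))"
      by (simp add: poly_var_def mult_single flip: single_add)
    then show ?case
      using mult[OF var[OF that] Suc] by simp
  qed
  have mon: "m = 0 \<or> S (?mon m)" if "Poly_Mapping.keys m \<subseteq> X" for m
  proof (rule poly_mapping_induct_on_keys[of "\<lambda>m. m = 0 \<or> S (?mon m)"])
    fix x
    assume "x \<in> Poly_Mapping.keys m"
    then show "Poly_Mapping.single x (Poly_Mapping.lookup m x) = 0 \<or>
        S (?mon (Poly_Mapping.single x (Poly_Mapping.lookup m x)))"
      using subsetD[OF that, of x] power[of x "Poly_Mapping.lookup m x - 1"]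
      by (cases "Poly_Mapping.lookup m x") (auto simp: in_keys_iff)
  next
    fix m l
    assume "m = 0 \<or> S (?mon m)" "l = 0 \<or> S (?mon l)"
    then show "m + l = 0 \<or> S (?mon (m + l))"
      using mult[of "?mon m" "?mon l"] by (auto simp: mult_single)
  qed simp
  show ?thesis
  proof (rule poly_mapping_induct_on_keys)
    fix m
    assume m: "m \<in> Poly_Mapping.keys q"
    then have "m \<noteq> 0"
      using q by (auto simp: in_keys_iff)
    then have "S (?mon m)"
      using mon[of m] m q by (auto simp: poly_vars_in_def)
    from coeff[OF m this] show "S (Poly_Mapping.single m (Poly_Mapping.lookup q m))"
      by (simp add: poly_const_def mult_single)
  qed (auto intro: zero add)
qed


subsection \<open>Integer-valued polynomials\<close>

lemma common_denominator:
  fixes h :: "'a \<Rightarrow> rat"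
  assumes "finite A"
  shows "\<exists>N::int. N \<noteq> 0 \<and> (\<forall>m\<in>A. of_int N * h m \<in> \<int>)"
  using assms
proof (induction A rule: finite_induct)
  case (insert m A)
  then obtain N :: int where N: "N \<noteq> 0" "\<forall>m\<in>A. of_int N * h m \<in> \<int>"
    by blast
  obtain k b where kb: "quotient_of (h m) = (k, b)"
    by fastforce
  have b: "b \<noteq> 0" "of_int b * h m = of_int k"
    using quotient_of_div[OF kb] quotient_of_denom_pos[OF kb] by auto
  have "of_int (N * b) * h l \<in> \<int>" if "l \<in> insert m A" for l
  proof (cases "l = m")
    case True
    have "of_int (N * b) * h m = of_int (N * k)"
      using b by (simp add: mult.assoc)
    then show ?thesis
      using True by (metis Ints_of_int)
  next
    case False
    have "of_int b * (of_int N * h l) \<in> \<int>"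
      by (rule Ints_mult[OF Ints_of_int]) (use N that False in auto)
    then show ?thesis
      by (simp add: mult_ac)
  qed
  then show ?case
    using N b by (intro exI[of _ "N * b"]) auto
qed (auto intro: exI[of _ 1])

lemma of_int_floor_poly_eval:
  "q \<in> int_valued_polys X \<Longrightarrow>
    of_int \<lfloor>poly_eval (\<lambda>x. of_int (a x)) q\<rfloor> = poly_eval (\<lambda>x. rat_of_int (a x)) q"
  by (auto simp: int_valued_polys_def of_int_floor_cancel)

lemma int_valued_polys_add:
  "p \<in> int_valued_polys X \<Longrightarrow> q \<in> int_valued_polys X \<Longrightarrow> p + q \<in> int_valued_polys X"
  and int_valued_polys_mult:
  "p \<in> int_valued_polys X \<Longrightarrow> q \<in> int_valued_polys X \<Longrightarrow> p * q \<in> int_valued_polys X"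
  and int_valued_polys_const: "poly_const (of_int r) \<in> int_valued_polys X"
  and int_valued_polys_var: "x \<in> X \<Longrightarrow> poly_var x \<in> int_valued_polys X"
  and int_valued_polys_zero: "0 \<in> int_valued_polys X"
  by (auto simp: int_valued_polys_def
      intro: poly_vars_in_add poly_vars_in_mult poly_vars_in_const poly_vars_in_var poly_vars_in_zero)

lemma evaluation_algebra_int_valued: "evaluation_algebra (int_valued X)"
proof
  fix q :: "('a \<Rightarrow>\<^sub>0 nat) \<Rightarrow>\<^sub>0 rat" and S :: "(('a \<Rightarrow>\<^sub>0 nat) \<Rightarrow>\<^sub>0 rat) \<Rightarrow> bool"
  let ?P = "int_valued X"
  assume q: "q \<in> ideal0 ?P"
    and zero: "S \<zero>\<^bsub>?P\<^esub>"
    and var: "\<And>x. x \<in> vars ?P \<Longrightarrow> S (var ?P x)"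
    and add: "\<And>p q. p \<in> ideal0 ?P \<Longrightarrow> q \<in> ideal0 ?P \<Longrightarrow> S p \<Longrightarrow> S q \<Longrightarrow> S (p \<oplus>\<^bsub>?P\<^esub> q)"
    and mult: "\<And>p q. p \<in> ideal0 ?P \<Longrightarrow> q \<in> ideal0 ?P \<Longrightarrow> S p \<Longrightarrow> S q \<Longrightarrow> S (p \<otimes>\<^bsub>?P\<^esub> q)"
    and smult: "\<And>r p. p \<in> ideal0 ?P \<Longrightarrow> S p \<Longrightarrow> S (r \<odot>\<^bsub>?P\<^esub> p)"
    and divide: "\<And>r p. r \<noteq> 0 \<Longrightarrow> p \<in> ideal0 ?P \<Longrightarrow> S (r \<odot>\<^bsub>?P\<^esub> p) \<Longrightarrow> S p"
  \<comment> \<open>A nonzero multiple of \<open>q\<close> has integer coefficients, so it is built from the variables without division.\<close>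
  obtain N :: int where N: "N \<noteq> 0" "\<forall>m\<in>Poly_Mapping.keys q. of_int N * Poly_Mapping.lookup q m \<in> \<int>"
    using common_denominator[of "Poly_Mapping.keys q" "Poly_Mapping.lookup q"] by auto
  let ?q = "poly_const (of_int N) * q"
  have "Poly_Mapping.keys ?q \<subseteq> Poly_Mapping.keys q"
    by (simp add: poly_const_mult keys_scale)
  then have integral: "Poly_Mapping.lookup ?q m \<in> \<int>" if "m \<in> Poly_Mapping.keys ?q" for m
    using N that by (auto simp: poly_const_mult)
  have "?q \<in> ideal0 ?P"
    using q by (auto simp: int_valued_def lookup_mult_zero int_valued_polys_mult int_valued_polys_const)
  moreover from this have "poly_vars_in X ?q"
    by (simp add: int_valued_def int_valued_polys_def)
  ultimately have "?q \<in> ideal0 ?P \<and> S ?q"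
  proof (intro poly_induct_zero_constant_term[of X ?q "\<lambda>q. q \<in> ideal0 ?P \<and> S q"])
    fix m p
    assume "m \<in> Poly_Mapping.keys ?q" and p: "p \<in> ideal0 ?P \<and> S p"
    then obtain c where "Poly_Mapping.lookup ?q m = of_int c"
      using integral by (blast elim: Ints_cases)
    then show "poly_const (Poly_Mapping.lookup ?q m) * p \<in> ideal0 ?P \<and>
        S (poly_const (Poly_Mapping.lookup ?q m) * p)"
      using p smult[of p c]
      by (auto simp: int_valued_def lookup_mult_zero int_valued_polys_mult int_valued_polys_const)
  qed (use zero var add mult in
      \<open>auto simp: int_valued_def lookup_mult_zero lookup_add int_valued_polys_add
        int_valued_polys_mult int_valued_polys_var int_valued_polys_zero\<close>)
  then show "S q"
    using divide[OF N(1) q] by (simp add: int_valued_def)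
next
  fix p q :: "('a \<Rightarrow>\<^sub>0 nat) \<Rightarrow>\<^sub>0 rat" and a :: "'a \<Rightarrow> int"
  let ?P = "int_valued X"
  assume p: "p \<in> ideal0 ?P"
  have int: "of_int (evl ?P r a) = poly_eval (\<lambda>x. rat_of_int (a x)) r" if "r \<in> int_valued_polys X" for r
    using of_int_floor_poly_eval[OF that] by (simp add: int_valued_def)
  have pP: "p \<in> int_valued_polys X"
    using p by (simp add: int_valued_def)
  have "rat_of_int (evl ?P (r \<odot>\<^bsub>?P\<^esub> p) a) = rat_of_int (r * evl ?P p a)" for r
    using pP int[OF int_valued_polys_mult[OF int_valued_polys_const pP], of r]
    by (simp add: int) (simp add: int_valued_def)
  then show "evl ?P (r \<odot>\<^bsub>?P\<^esub> p) a = r * evl ?P p a" for r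
    using of_int_eq_iff by blast
  assume "q \<in> ideal0 ?P"
  then have qP: "q \<in> int_valued_polys X"
    by (simp add: int_valued_def)
  have "rat_of_int (evl ?P (p \<oplus>\<^bsub>?P\<^esub> q) a) = rat_of_int (evl ?P p a + evl ?P q a)"
    using pP qP int[OF int_valued_polys_add[OF pP qP]] by (simp add: int) (simp add: int_valued_def)
  then show "evl ?P (p \<oplus>\<^bsub>?P\<^esub> q) a = evl ?P p a + evl ?P q a"
    using of_int_eq_iff by blast
  have "rat_of_int (evl ?P (p \<otimes>\<^bsub>?P\<^esub> q) a) = rat_of_int (evl ?P p a * evl ?P q a)"
    using pP qP int[OF int_valued_polys_mult[OF pP qP]] by (simp add: int) (simp add: int_valued_def)
  then show "evl ?P (p \<otimes>\<^bsub>?P\<^esub> q) a = evl ?P p a * evl ?P q a"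
    using of_int_eq_iff by blast
qed (auto simp: int_valued_def lookup_mult_zero lookup_add int_valued_polys_add int_valued_polys_const
    int_valued_polys_mult int_valued_polys_var int_valued_polys_zero scale_zero poly_const_mult[of 0])


subsection \<open>Polynomials modulo the Fermat relations\<close>

lemma cring_poly_ring: "cring (poly_ring X :: (('x \<Rightarrow>\<^sub>0 nat) \<Rightarrow>\<^sub>0 'k::comm_ring_1) ring)"
proof (intro cringI abelian_groupI comm_monoidI)
  fix p :: "('x \<Rightarrow>\<^sub>0 nat) \<Rightarrow>\<^sub>0 'k"
  assume "p \<in> carrier (poly_ring X)"
  then show "\<exists>q\<in>carrier (poly_ring X). q \<oplus>\<^bsub>poly_ring X\<^esub> p = \<zero>\<^bsub>poly_ring X\<^esub>"
    by (intro bexI[of _ "- p"]) (auto simp: poly_ring_def poly_vars_in_uminus)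
qed (auto simp: poly_ring_def algebra_simps
    intro: poly_vars_in_add poly_vars_in_mult poly_vars_in_zero poly_vars_in_one)

lemma ideal_vanishing_polys:
  "ideal {q. poly_vars_in X q \<and> (\<forall>a. poly_eval a q = 0)}
    (poly_ring X :: (('x \<Rightarrow>\<^sub>0 nat) \<Rightarrow>\<^sub>0 'k::comm_ring_1) ring)"
    (is "ideal ?I ?R")
proof -
  interpret R: cring ?R
    by (rule cring_poly_ring)
  have minus: "\<ominus>\<^bsub>?R\<^esub> q = - q" if "poly_vars_in X q" for q :: "('x \<Rightarrow>\<^sub>0 nat) \<Rightarrow>\<^sub>0 'k"
    using that by (intro R.minus_equality) (auto simp: poly_ring_def poly_vars_in_uminus)
  show ?thesis
  proof (rule idealI[OF R.ring_axioms])
    show "subgroup ?I (add_monoid ?R)"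
      by (rule R.add.subgroupI)
        (use minus in \<open>auto simp: a_inv_def[symmetric] poly_ring_def
          intro: poly_vars_in_zero poly_vars_in_add poly_vars_in_uminus exI[of _ 0]\<close>)
  qed (auto simp: poly_ring_def intro: poly_vars_in_mult)
qed

lemma fermat_generators_subset:
  "(\<lambda>x. poly_var x ^ CARD('p) - poly_var x) ` X \<subseteq>
    carrier (poly_ring X :: (('x \<Rightarrow>\<^sub>0 nat) \<Rightarrow>\<^sub>0 'p::prime_card mod_ring) ring)"
  by (auto simp: poly_ring_def intro!: poly_vars_in_diff poly_vars_in_power poly_vars_in_var)

lemma ideal_fermat_ideal:
  "ideal (fermat_ideal X :: (('x \<Rightarrow>\<^sub>0 nat) \<Rightarrow>\<^sub>0 'p::prime_card mod_ring) set) (poly_ring X)"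
proof -
  interpret R: cring "poly_ring X :: (('x \<Rightarrow>\<^sub>0 nat) \<Rightarrow>\<^sub>0 'p mod_ring) ring"
    by (rule cring_poly_ring)
  show ?thesis
    unfolding fermat_ideal_def by (rule R.genideal_ideal[OF fermat_generators_subset])
qed

text \<open>By Fermat's little theorem the relations hold at every function.\<close>

lemma fermat_ideal_vanishes:
  assumes "q \<in> (fermat_ideal X :: (('x \<Rightarrow>\<^sub>0 nat) \<Rightarrow>\<^sub>0 'p::prime_card mod_ring) set)"
  shows "poly_eval a q = 0"
proof -
  let ?R = "poly_ring X :: (('x \<Rightarrow>\<^sub>0 nat) \<Rightarrow>\<^sub>0 'p mod_ring) ring"
  interpret R: cring ?R
    by (rule cring_poly_ring)
  have "c ^ CARD('p) = c" for c :: "'p mod_ring"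
    using finite_field_power_card_eq_same[of c] by simp
  then have "(\<lambda>x. poly_var x ^ CARD('p) - poly_var x) ` X \<subseteq>
      {q :: ('x \<Rightarrow>\<^sub>0 nat) \<Rightarrow>\<^sub>0 'p mod_ring. poly_vars_in X q \<and> (\<forall>a. poly_eval a q = 0)}"
    using fermat_generators_subset[of X] by (auto simp: poly_ring_def)
  from R.genideal_minimal[OF ideal_vanishing_polys this] show ?thesis
    using assms by (auto simp: fermat_ideal_def)
qed

lemma evaluation_algebra_mod_p_polys:
  "evaluation_algebra (mod_p_polys X :: ('p::prime_card mod_ring, _, 'x) poly_alg)"
proof -
  let ?R = "poly_ring X :: (('x \<Rightarrow>\<^sub>0 nat) \<Rightarrow>\<^sub>0 'p mod_ring) ring"
  let ?P = "mod_p_polys X :: ('p mod_ring, _, 'x) poly_alg"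
  define cls where "cls = (\<lambda>q. fermat_ideal X +>\<^bsub>?R\<^esub> q)"
  interpret R: cring ?R
    by (rule cring_poly_ring)
  interpret I: ideal "fermat_ideal X" ?R
    by (rule ideal_fermat_ideal)
  have hom: "cls \<in> Ring.ring_hom ?R (?R Quot fermat_ideal X)"
    unfolding cls_def by (rule I.rcos_ring_hom)
  have R [simp]: "carrier ?R = {q. poly_vars_in X q}" "p \<oplus>\<^bsub>?R\<^esub> q = p + q" "p \<otimes>\<^bsub>?R\<^esub> q = p * q"
    "\<zero>\<^bsub>?R\<^esub> = 0" for p q
    by (auto simp: poly_ring_def)
  have add: "cls p \<oplus>\<^bsub>?P\<^esub> cls q = cls (p + q)" if "poly_vars_in X p" "poly_vars_in X q" for p q
    using Ring.ring_hom_add[OF hom, of p q] that by (simp add: mod_p_polys_def Let_def)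
  have mult: "cls p \<otimes>\<^bsub>?P\<^esub> cls q = cls (p * q)" if "poly_vars_in X p" "poly_vars_in X q" for p q
    using Ring.ring_hom_mult[OF hom, of p q] that by (simp add: mod_p_polys_def Let_def)
  have smult: "r \<odot>\<^bsub>?P\<^esub> cls q = cls (poly_const r * q)" if "poly_vars_in X q" for r q
    using Ring.ring_hom_mult[OF hom, of "poly_const r" q] that poly_vars_in_const[of X r]
    by (simp add: mod_p_polys_def Let_def cls_def)
  have zero: "\<zero>\<^bsub>?P\<^esub> = cls 0"
    using Ring.ring_hom_zero[OF hom R.ring_axioms I.quotient_is_ring] by (simp add: mod_p_polys_def Let_def)
  have self: "q \<in> cls q" if "poly_vars_in X q" for q
    using I.a_rcos_self[of q] that by (simp add: cls_def)
  have eval: "poly_eval a q' = poly_eval a q" if "q' \<in> cls q" for q q' a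
    using that by (auto simp: cls_def a_r_coset_def' fermat_ideal_vanishes)
  then have lookup: "Poly_Mapping.lookup q' 0 = Poly_Mapping.lookup q 0" if "q' \<in> cls q" for q q'
    using eval[OF that, of "\<lambda>_. 0"] by (simp only: poly_eval_at_zero)
  have evl: "evl ?P (cls q) a = poly_eval a q" if "poly_vars_in X q" for q a
  proof -
    have "(THE v. \<forall>q'\<in>cls q. poly_eval a q' = v) = poly_eval a q"
    proof (rule the_equality)
      show "\<forall>q'\<in>cls q. poly_eval a q' = poly_eval a q"
        using eval by blast
      show "v = poly_eval a q" if "\<forall>q'\<in>cls q. poly_eval a q' = v" for v
        using that self[OF \<open>poly_vars_in X q\<close>] by simp
    qed
    then show ?thesis
      by (simp add: mod_p_polys_def Let_def)
  qed
  have carrier: "carrier (?R Quot fermat_ideal X) = cls ` {q. poly_vars_in X q}"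
    by (auto simp: FactRing_def A_RCOSETS_def' cls_def)
  have ideal0: "ideal0 ?P = cls ` {q. poly_vars_in X q \<and> Poly_Mapping.lookup q 0 = 0}"
  proof -
    have "ideal0 ?P = {C \<in> cls ` {q. poly_vars_in X q}. \<forall>q\<in>C. Poly_Mapping.lookup q 0 = 0}"
      by (simp add: mod_p_polys_def Let_def carrier)
    moreover have "(\<forall>q'\<in>cls q. Poly_Mapping.lookup q' 0 = 0) \<longleftrightarrow> Poly_Mapping.lookup q 0 = 0"
      if "poly_vars_in X q" for q
      using self[OF that] lookup[of _ q] by metis
    ultimately show ?thesis
      by auto
  qed
  have var: "var ?P x = cls (poly_var x)" and vars: "vars ?P = X" for x
    by (simp_all add: mod_p_polys_def Let_def cls_def)
  note closed = poly_vars_in_add poly_vars_in_mult poly_vars_in_const poly_vars_in_var poly_vars_in_zero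
  note simps = ideal0 add mult smult zero evl var vars closed lookup_add lookup_mult_zero
  show ?thesis
  proof
    fix C and S :: "(('x \<Rightarrow>\<^sub>0 nat) \<Rightarrow>\<^sub>0 'p mod_ring) set \<Rightarrow> bool"
    assume "C \<in> ideal0 ?P"
      and S: "S \<zero>\<^bsub>?P\<^esub>"
      "\<And>x. x \<in> vars ?P \<Longrightarrow> S (var ?P x)"
      "\<And>p q. p \<in> ideal0 ?P \<Longrightarrow> q \<in> ideal0 ?P \<Longrightarrow> S p \<Longrightarrow> S q \<Longrightarrow> S (p \<oplus>\<^bsub>?P\<^esub> q)"
      "\<And>p q. p \<in> ideal0 ?P \<Longrightarrow> q \<in> ideal0 ?P \<Longrightarrow> S p \<Longrightarrow> S q \<Longrightarrow> S (p \<otimes>\<^bsub>?P\<^esub> q)"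
      "\<And>r p. p \<in> ideal0 ?P \<Longrightarrow> S p \<Longrightarrow> S (r \<odot>\<^bsub>?P\<^esub> p)"
    then obtain q where q: "C = cls q" "poly_vars_in X q" "Poly_Mapping.lookup q 0 = 0"
      by (auto simp: ideal0)
    let ?S = "\<lambda>q. poly_vars_in X q \<and> Poly_Mapping.lookup q 0 = 0 \<and> S (cls q)"
    have in_ideal0: "cls p \<in> ideal0 ?P" if "?S p" for p
      using that by (auto simp: ideal0)
    have "?S q"
    proof (rule poly_induct_zero_constant_term[of X q ?S])
      fix m p
      assume p: "?S p"
      show "?S (poly_const (Poly_Mapping.lookup q m) * p)"
        using S(5)[OF in_ideal0[OF p], of "Poly_Mapping.lookup q m"] p by (simp add: simps)
    next
      fix p p'
      assume p: "?S p" "?S p'"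
      show "?S (p + p')" "?S (p * p')"
        using S(3)[OF p[THEN in_ideal0]] S(4)[OF p[THEN in_ideal0]] p by (simp_all add: simps)
    qed (use q S(1,2) in \<open>simp_all add: simps\<close>)
    then show "S C"
      using q by simp
  qed (auto simp: simps scale_zero poly_const_mult[of 0])
qed


section \<open>Differentials on the tensor algebra and their evaluation\<close>

lemma is_linearD:
  assumes "is_linear M N f"
  shows is_linear_closed: "x \<in> carrier M \<Longrightarrow> f x \<in> carrier N"
    and is_linear_add: "x \<in> carrier M \<Longrightarrow> y \<in> carrier M \<Longrightarrow> f (x \<oplus>\<^bsub>M\<^esub> y) = f x \<oplus>\<^bsub>N\<^esub> f y"
    and is_linear_smult: "x \<in> carrier M \<Longrightarrow> f (r \<odot>\<^bsub>M\<^esub> x) = r \<odot>\<^bsub>N\<^esub> f x"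
  using assms by (auto simp: is_linear_def)

lemma is_bilinear_closed:
  "is_bilinear M N L f \<Longrightarrow> x \<in> carrier M \<Longrightarrow> y \<in> carrier N \<Longrightarrow> f x y \<in> carrier L"
  by (auto simp: is_bilinear_def intro: is_linear_closed)

lemma face_bar_Cons:
  assumes "0 < i" "i \<le> Suc n" "length as = Suc n"
  shows "face (bar H) (Suc (Suc n)) (Suc i) (a # as) = a # face (bar H) (Suc n) i as"
  using assms by (cases i) (auto simp: bar_def)

lemma length_face_bar:
  assumes "i \<le> Suc n" "length as = Suc n"
  shows "length (face (bar H) (Suc n) i as) = n"
  using assms by (auto simp: bar_def)

text \<open>
  A binomial \<open>\<union>\<^sub>1\<close>-dga \<open>M\<close> on the tensor algebra of an evaluation algebra.  Its operations are
  unions of classes over all representatives; as they are assumed to take values in the components, which consist of classes,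
  any representative of a value determines it, and the independence of representatives need not be checked.
\<close>

locale evaluation_dga = evaluation_algebra P
  for P :: "('r::idom, 'q, 'x) poly_alg" +
  fixes d :: "nat \<Rightarrow> ('r, 'q) tensor \<Rightarrow> ('r, 'q) tensor"
  assumes dga: "binomial_cup1_dga (free_dga P d)"
begin

abbreviation M :: "('r, ('r, 'q) tensor) cup1_dga" where
  "M \<equiv> free_dga P d"

abbreviation G :: "('x \<Rightarrow> 'r) monoid" where
  "G \<equiv> hirsch_group P d"

abbreviation word_class :: "'q list \<Rightarrow> ('r, 'q) tensor" where
  "word_class w \<equiv> tensor_class P (length w) (word w)"

lemma diff_M [simp]: "diff M = d"
  and unit_M: "unit M = word_class []"
  and zero_M: "\<zero>\<^bsub>comp M n\<^esub> = tensor_class P n 0"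
  and add_M: "U \<oplus>\<^bsub>comp M n\<^esub> V = (\<Union>u\<in>U. \<Union>v\<in>V. tensor_class P n (u + v))"
  and smult_M: "r \<odot>\<^bsub>comp M n\<^esub> U = (\<Union>u\<in>U. tensor_class P n (scale r u))"
  and comps_M: "comps M n = tensor_class P n ` free_words P n"
  and cup_M: "cup M i j = tensor_op P (i + j) (\<lambda>w z. word (w @ z))"
  and cup1_M: "cup1 M = tensor_op P 1 (\<lambda>w z. word [w ! 0 \<otimes>\<^bsub>P\<^esub> z ! 0])"
  and dcup1_M: "dcup1 M = tensor_op P 2
        (\<lambda>w z. word [w ! 0, w ! 1 \<otimes>\<^bsub>P\<^esub> z ! 0] + word [w ! 0 \<otimes>\<^bsub>P\<^esub> z ! 0, w ! 1])"
  and circ_M: "circ M = tensor_op P 2 (\<lambda>w z. word [w ! 0 \<otimes>\<^bsub>P\<^esub> z ! 0, w ! 1 \<otimes>\<^bsub>P\<^esub> z ! 1])"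
  by (simp_all add: free_dga_def)

lemma algebra_M: "binomial_cup1_algebra M" and graded_M: "graded_algebra M"
  using dga by (auto simp: binomial_cup1_dga_def binomial_cup1_algebra_def)

lemma module_M: "module base_ring (comp M n)"
  using graded_M by (simp add: graded_algebra_def)

lemma zero_comps [simp]: "\<zero>\<^bsub>comp M n\<^esub> \<in> comps M n"
  and add_comps [simp]: "U \<in> comps M n \<Longrightarrow> V \<in> comps M n \<Longrightarrow> U \<oplus>\<^bsub>comp M n\<^esub> V \<in> comps M n"
  and smult_comps [simp]: "U \<in> comps M n \<Longrightarrow> r \<odot>\<^bsub>comp M n\<^esub> U \<in> comps M n"
  and a_inv_comps [simp]: "U \<in> comps M n \<Longrightarrow> \<ominus>\<^bsub>comp M n\<^esub> U \<in> comps M n"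
  and a_minus_comps [simp]: "U \<in> comps M n \<Longrightarrow> V \<in> comps M n \<Longrightarrow> U \<ominus>\<^bsub>comp M n\<^esub> V \<in> comps M n"
  and add_a_inv: "U \<in> comps M n \<Longrightarrow> U \<oplus>\<^bsub>comp M n\<^esub> \<ominus>\<^bsub>comp M n\<^esub> U = \<zero>\<^bsub>comp M n\<^esub>"
proof -
  interpret module base_ring "comp M n"
    by (rule module_M)
  have "carrier base_ring = (UNIV :: 'r set)"
    by (simp add: base_ring_def)
  then show "\<zero>\<^bsub>comp M n\<^esub> \<in> comps M n"
    "U \<in> comps M n \<Longrightarrow> V \<in> comps M n \<Longrightarrow> U \<oplus>\<^bsub>comp M n\<^esub> V \<in> comps M n"
    "U \<in> comps M n \<Longrightarrow> r \<odot>\<^bsub>comp M n\<^esub> U \<in> comps M n"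
    "U \<in> comps M n \<Longrightarrow> \<ominus>\<^bsub>comp M n\<^esub> U \<in> comps M n"
    "U \<in> comps M n \<Longrightarrow> V \<in> comps M n \<Longrightarrow> U \<ominus>\<^bsub>comp M n\<^esub> V \<in> comps M n"
    "U \<in> comps M n \<Longrightarrow> U \<oplus>\<^bsub>comp M n\<^esub> \<ominus>\<^bsub>comp M n\<^esub> U = \<zero>\<^bsub>comp M n\<^esub>"
    by (auto simp: M.r_neg)
qed

lemma unit_comps: "unit M \<in> comps M 0"
  using graded_M by (simp add: graded_algebra_def)

lemma cup_comps: "U \<in> comps M i \<Longrightarrow> V \<in> comps M j \<Longrightarrow> cup M i j U V \<in> comps M (i + j)"
  using graded_M by (auto simp: graded_algebra_def intro: is_bilinear_closed)

lemma cup1_comps: "U \<in> comps M 1 \<Longrightarrow> V \<in> comps M 1 \<Longrightarrow> cup1 M U V \<in> comps M 1"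
  using algebra_M by (auto simp: binomial_cup1_algebra_def intro: is_bilinear_closed)

lemma dcup1_decomposables:
  "U \<in> decomposables M \<Longrightarrow> V \<in> comps M 1 \<Longrightarrow> dcup1 M U V \<in> decomposables M"
  using algebra_M is_bilinear_closed[of "D2 M" "comp M 1" "D2 M"]
  by (auto simp: binomial_cup1_algebra_def D2_def)

lemma circ_decomposables:
  "U \<in> decomposables M \<Longrightarrow> V \<in> decomposables M \<Longrightarrow> circ M U V \<in> decomposables M"
  using algebra_M is_bilinear_closed[of "D2 M" "D2 M" "D2 M"]
  by (auto simp: binomial_cup1_algebra_def D2_def)

lemma is_linear_d: "is_linear (comp M n) (comp M (Suc n)) (d n)"
  using dga by (simp add: binomial_cup1_dga_def)

lemma d_comps: "U \<in> comps M n \<Longrightarrow> d n U \<in> comps M (Suc n)"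
  and d_add: "U \<in> comps M n \<Longrightarrow> V \<in> comps M n \<Longrightarrow>
    d n (U \<oplus>\<^bsub>comp M n\<^esub> V) = d n U \<oplus>\<^bsub>comp M (Suc n)\<^esub> d n V"
  and d_smult: "U \<in> comps M n \<Longrightarrow> d n (r \<odot>\<^bsub>comp M n\<^esub> U) = r \<odot>\<^bsub>comp M (Suc n)\<^esub> d n U"
  using is_linearD[OF is_linear_d] by simp_all

lemma d_cup:
  "U \<in> comps M i \<Longrightarrow> V \<in> comps M j \<Longrightarrow>
    d (i + j) (cup M i j U V) = cup M (Suc i) j (d i U) V
      \<oplus>\<^bsub>comp M (Suc (i + j))\<^esub> (-1) ^ i \<odot>\<^bsub>comp M (Suc (i + j))\<^esub> cup M i (Suc j) U (d j V)"
  using dga unfolding binomial_cup1_dga_def diff_M by blast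

lemma member_free_words: "U \<in> comps M n \<Longrightarrow> u \<in> U \<Longrightarrow> u \<in> free_words P n"
  using free_words_add tensor_rels_free_words
  by (fastforce simp: comps_M tensor_class_def dest: free_words_add[of _ n "u - _"])

lemma comps_eq_class: "U \<in> comps M n \<Longrightarrow> u \<in> U \<Longrightarrow> U = tensor_class P n u"
  by (auto simp: comps_M tensor_class_eqI)

lemma class_comps: "u \<in> free_words P n \<Longrightarrow> tensor_class P n u \<in> comps M n"
  by (simp add: comps_M)

lemma word_class_comps [simp]: "set w \<subseteq> ideal0 P \<Longrightarrow> word_class w \<in> comps M (length w)"
  by (simp add: class_comps free_words_word)

lemma class_add:
  assumes "u \<in> free_words P n" "v \<in> free_words P n"
  shows "tensor_class P n (u + v) = tensor_class P n u \<oplus>\<^bsub>comp M n\<^esub> tensor_class P n v"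
proof -
  have "u + v \<in> tensor_class P n u \<oplus>\<^bsub>comp M n\<^esub> tensor_class P n v"
    unfolding add_M using self_in_tensor_class by blast
  then show ?thesis
    using comps_eq_class assms by (metis add_comps class_comps)
qed

lemma class_scale:
  assumes "u \<in> free_words P n"
  shows "tensor_class P n (scale r u) = r \<odot>\<^bsub>comp M n\<^esub> tensor_class P n u"
proof -
  have "scale r u \<in> r \<odot>\<^bsub>comp M n\<^esub> tensor_class P n u"
    unfolding smult_M using self_in_tensor_class by blast
  then show ?thesis
    using comps_eq_class assms by (metis smult_comps class_comps)
qed

lemma comps_induct [consumes 1, case_names zero word add smult]:
  assumes "U \<in> comps M n"
    and zero: "S \<zero>\<^bsub>comp M n\<^esub>"
    and word: "\<And>w. length w = n \<Longrightarrow> set w \<subseteq> ideal0 P \<Longrightarrow> S (word_class w)"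
    and add: "\<And>U V. U \<in> comps M n \<Longrightarrow> V \<in> comps M n \<Longrightarrow> S U \<Longrightarrow> S V \<Longrightarrow> S (U \<oplus>\<^bsub>comp M n\<^esub> V)"
    and smult: "\<And>r U. U \<in> comps M n \<Longrightarrow> S U \<Longrightarrow> S (r \<odot>\<^bsub>comp M n\<^esub> U)"
  shows "S U"
proof -
  obtain u where u: "u \<in> free_words P n" "U = tensor_class P n u"
    using assms(1) by (auto simp: comps_M)
  let ?S = "\<lambda>u. u \<in> free_words P n \<and> S (tensor_class P n u)"
  have "?S u"
  proof (rule poly_mapping_induct_on_keys)
    show "?S 0"
      using zero by (simp add: zero_M free_words_zero)
    show "?S (v + v')" if "?S v" "?S v'" for v v'
      using that by (simp add: free_words_add class_add add class_comps)
    fix w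
    assume "w \<in> Poly_Mapping.keys u"
    then have w: "length w = n" "set w \<subseteq> ideal0 P"
      using u by (auto simp: free_words_def)
    have "Poly_Mapping.single w c = scale c (word w)" for c :: 'r
      by (rule poly_mapping_eqI) (simp add: word_def lookup_single when_def)
    then show "?S (Poly_Mapping.single w (Poly_Mapping.lookup u w))"
      using w word[OF w] by (simp add: class_scale smult class_comps free_words_word free_words_scale)
  qed
  then show ?thesis
    using u by simp
qed

lemma tensor_op_word:
  "f w z \<in> tensor_op P k f (tensor_class P i (word w)) (tensor_class P j (word z))"
proof -
  have "scale 1 u = u" for u :: "'q list \<Rightarrow>\<^sub>0 'r"
    by (rule poly_mapping_eqI) simp
  then have "bilinear_extension f (word w) (word z) = f w z"
    by (simp add: bilinear_extension_def word_def)
  then show ?thesis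
    unfolding tensor_op_def by (intro UN_I[of "word w"] UN_I[of "word z"]) simp_all
qed

lemma cup_word_class:
  assumes "set w \<subseteq> ideal0 P" "set z \<subseteq> ideal0 P"
  shows "cup M (length w) (length z) (word_class w) (word_class z) = word_class (w @ z)"
  using comps_eq_class[OF cup_comps[OF word_class_comps[OF assms(1)] word_class_comps[OF assms(2)]]]
    tensor_op_word[of "\<lambda>w z. word (w @ z)" w z] by (simp add: cup_M)

lemma cup1_word_class:
  assumes "p \<in> ideal0 P" "q \<in> ideal0 P"
  shows "cup1 M (word_class [p]) (word_class [q]) = word_class [p \<otimes>\<^bsub>P\<^esub> q]"
proof -
  have "word [p \<otimes>\<^bsub>P\<^esub> q] \<in> cup1 M (word_class [p]) (word_class [q])"
    using tensor_op_word[of "\<lambda>w z. word [w ! 0 \<otimes>\<^bsub>P\<^esub> z ! 0]" "[p]" "[q]" 1 1 1]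
    by (simp add: cup1_M)
  moreover have "cup1 M (word_class [p]) (word_class [q]) \<in> comps M 1"
    using cup1_comps word_class_comps[of "[p]"] word_class_comps[of "[q]"] assms by simp
  ultimately have "cup1 M (word_class [p]) (word_class [q]) = tensor_class P 1 (word [p \<otimes>\<^bsub>P\<^esub> q])"
    by (intro comps_eq_class)
  then show ?thesis
    by simp
qed

lemma word_class_add:
  assumes "p \<in> ideal0 P" "q \<in> ideal0 P"
  shows "word_class [p \<oplus>\<^bsub>P\<^esub> q] = word_class [p] \<oplus>\<^bsub>comp M 1\<^esub> word_class [q]"
proof -
  have "word [p \<oplus>\<^bsub>P\<^esub> q] \<in> tensor_class P 1 (word [p] + word [q])"
    using tensor_rels.additive[of "[]" P "[]" p q 1] assms by (simp add: tensor_class_def diff_diff_eq)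
  from tensor_class_eqI[OF this] show ?thesis
    using class_add[of "word [p]" 1 "word [q]"] assms by (simp add: free_words_word)
qed

lemma word_class_smult:
  assumes "p \<in> ideal0 P"
  shows "word_class [r \<odot>\<^bsub>P\<^esub> p] = r \<odot>\<^bsub>comp M 1\<^esub> word_class [p]"
proof -
  have "word [r \<odot>\<^bsub>P\<^esub> p] \<in> tensor_class P 1 (scale r (word [p]))"
    using tensor_rels.homogeneous[of "[]" P "[]" p 1 r] assms by (simp add: tensor_class_def)
  from tensor_class_eqI[OF this] show ?thesis
    using class_scale[of "word [p]" 1] assms by (simp add: free_words_word)
qed

text \<open>All tensors of degree two are decomposable.\<close>

lemma decomposables_M: "decomposables M = comps M 2"
proof
  show "decomposables M \<subseteq> comps M 2"
  proof
    fix U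
    assume "U \<in> decomposables M"
    then show "U \<in> comps M 2"
    proof (induction rule: decomposables.induct)
      case (cup a b)
      then show ?case
        using cup_comps[of a 1 b 1] by (simp add: numeral_2_eq_2)
    qed auto
  qed
  show "comps M 2 \<subseteq> decomposables M"
  proof
    fix U
    assume "U \<in> comps M 2"
    then show "U \<in> decomposables M"
    proof (induction rule: comps_induct)
      case (word w)
      then obtain p q where w: "w = [p] @ [q]"
        by (auto simp: numeral_2_eq_2 length_Suc_conv)
      then show ?case
        using word cup_word_class[of "[p]" "[q]"] decomposables.cup[of "word_class [p]" M "word_class [q]"]
          word_class_comps[of "[p]"] word_class_comps[of "[q]"] by simp
    qed (auto intro: decomposables.intros)
  qed
qed


subsection \<open>Evaluation is compatible with the operations\<close>

abbreviation E :: "('x \<Rightarrow> 'r) list \<Rightarrow> ('r, 'q) tensor \<Rightarrow> 'r" where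
  "E \<equiv> tensor_eval P"

lemma eval_member:
  "U \<in> comps M n \<Longrightarrow> length as = n \<Longrightarrow> u \<in> U \<Longrightarrow> eval_words as u = E as U"
  using comps_eq_class by fastforce

lemma E_zero: "length as = n \<Longrightarrow> E as \<zero>\<^bsub>comp M n\<^esub> = 0"
  by (simp add: zero_M)

lemma E_word_class: "length as = length w \<Longrightarrow> E as (word_class w) = word_eval as w"
  by simp

lemma E_add:
  assumes "U \<in> comps M n" "V \<in> comps M n" "length as = n"
  shows "E as (U \<oplus>\<^bsub>comp M n\<^esub> V) = E as U + E as V"
proof -
  obtain u v where "u \<in> free_words P n" "U = tensor_class P n u"
    "v \<in> free_words P n" "V = tensor_class P n v"
    using assms by (auto simp: comps_M)
  then show ?thesis
    using assms(3) by (simp flip: class_add)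
qed

lemma E_smult:
  assumes "U \<in> comps M n" "length as = n"
  shows "E as (r \<odot>\<^bsub>comp M n\<^esub> U) = r * E as U"
proof -
  obtain u where "u \<in> free_words P n" "U = tensor_class P n u"
    using assms by (auto simp: comps_M)
  then show ?thesis
    using assms(2) by (simp flip: class_scale)
qed

lemma E_a_inv:
  assumes "U \<in> comps M n" "length as = n"
  shows "E as (\<ominus>\<^bsub>comp M n\<^esub> U) = - E as U"
  using E_add[of U n "\<ominus>\<^bsub>comp M n\<^esub> U" as] assms
  by (simp add: add_a_inv E_zero minus_unique[symmetric])

lemma E_a_minus:
  assumes "U \<in> comps M n" "V \<in> comps M n" "length as = n"
  shows "E as (U \<ominus>\<^bsub>comp M n\<^esub> V) = E as U - E as V"
  using assms by (simp add: a_minus_def E_add E_a_inv)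

lemma E_tensor_op:
  assumes "U \<in> comps M i" "V \<in> comps M j" "length as = k"
    and f: "\<And>w z. length w = i \<Longrightarrow> set w \<subseteq> ideal0 P \<Longrightarrow> length z = j \<Longrightarrow> set z \<subseteq> ideal0 P \<Longrightarrow>
      eval_words as (f w z) = g w * h z"
    and g: "\<And>u. u \<in> U \<Longrightarrow> linear_extension g u = c"
    and h: "\<And>v. v \<in> V \<Longrightarrow> linear_extension h v = c'"
  shows "E as (tensor_op P k f U V) = c * c'"
proof -
  have bil: "eval_words as (bilinear_extension f u v) = c * c'" if "u \<in> U" "v \<in> V" for u v
  proof -
    have "u \<in> free_words P i" "v \<in> free_words P j"
      using that assms member_free_words by auto
    then have "eval_words as (bilinear_extension f u v) = linear_extension g u * linear_extension h v"
      by (intro linear_extension_bilinear f) (auto simp: free_words_def)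
    then show ?thesis
      using that g h by simp
  qed
  obtain u v where uv: "u \<in> U" "v \<in> V"
    using assms(1,2) self_in_tensor_class unfolding comps_M by blast
  show ?thesis
  proof (rule tensor_evalI)
    show "bilinear_extension f u v \<in> tensor_op P k f U V"
      using uv self_in_tensor_class unfolding tensor_op_def by blast
    fix w
    assume "w \<in> tensor_op P k f U V"
    then obtain u v where "u \<in> U" "v \<in> V" "w \<in> tensor_class P k (bilinear_extension f u v)"
      unfolding tensor_op_def by blast
    then show "eval_words as w = c * c'"
      using bil eval_tensor_class assms(3) by metis
  qed
qed

lemma E_cup:
  assumes "U \<in> comps M i" "V \<in> comps M j" "length as = i + j"
  shows "E as (cup M i j U V) = E (take i as) U * E (drop i as) V"
  unfolding cup_M
  by (rule E_tensor_op[OF assms, where g = "word_eval (take i as)" and h = "word_eval (drop i as)"])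
    (use assms in \<open>auto simp: word_eval_append eval_member\<close>)

lemma E_cup1:
  assumes "U \<in> comps M 1" "V \<in> comps M 1"
  shows "E [a] (cup1 M U V) = E [a] U * E [a] V"
  unfolding cup1_M
  by (rule E_tensor_op[OF assms, where g = "word_eval [a]" and h = "word_eval [a]"])
    (use assms in \<open>auto simp: eval_member length_Suc_conv\<close>)

lemma E_dcup1:
  assumes "U \<in> comps M 2" "V \<in> comps M 1"
  shows "E [a, b] (dcup1 M U V) = E [a, b] U * (E [a] V + E [b] V)"
proof -
  have "linear_extension (\<lambda>z. word_eval [a] z + word_eval [b] z) v = E [a] V + E [b] V" if "v \<in> V" for v
    using that assms(2) eval_member[of V 1 "[a]" v] eval_member[of V 1 "[b]" v]
    by (simp add: linear_extension_def distrib_left sum.distrib)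
  then show ?thesis
    unfolding dcup1_M
    by (intro E_tensor_op[OF assms, where g = "word_eval [a, b]"])
      (use assms in \<open>auto simp: eval_member length_Suc_conv numeral_2_eq_2 algebra_simps\<close>)
qed

lemma E_circ:
  assumes "U \<in> comps M 2" "V \<in> comps M 2"
  shows "E [a, b] (circ M U V) = E [a, b] U * E [a, b] V"
  unfolding circ_M
  by (rule E_tensor_op[OF assms, where g = "word_eval [a, b]" and h = "word_eval [a, b]"])
    (use assms in \<open>auto simp: eval_member length_Suc_conv numeral_2_eq_2\<close>)


subsection \<open>Evaluation of the differential\<close>

lemma hirsch_group_mult: "a \<otimes>\<^bsub>G\<^esub> b = (\<lambda>x\<in>vars P. a x + b x - E [a, b] (d 1 (gen P x)))"
  by (simp add: hirsch_group_def)

lemma carrier_G: "carrier G = vars P \<rightarrow>\<^sub>E UNIV"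
  by (simp add: hirsch_group_def)

lemma gen_word_class: "gen P x = word_class [var P x]"
  by (simp add: gen_def)

lemma gen_comps: "x \<in> vars P \<Longrightarrow> gen P x \<in> comps M 1"
  using word_class_comps[of "[var P x]"] by (simp add: gen_word_class)

text \<open>
  For variables the next identity is the definition of the product in \<open>G\<close>.  The formula for
  \<open>d (p \<union>\<^sub>1 q)\<close> makes it inherit to products, and \<open>R\<close> being a domain to quotients by scalars.
\<close>

lemma E_d_degree_one:
  assumes "p \<in> ideal0 P"
  shows "E [a, b] (d 1 (word_class [p])) = evl P p a + evl P p b - evl P p (a \<otimes>\<^bsub>G\<^esub> b)"
  using assms
proof (induction p rule: ideal0_induct)
  have closed: "word_class [p] \<in> comps M 1" "d 1 (word_class [p]) \<in> comps M 2" if "p \<in> ideal0 P" for p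
    using that word_class_comps[of "[p]"] d_comps[of "word_class [p]" 1] by (auto simp: numeral_2_eq_2)
  have scaled: "E [a, b] (d 1 (word_class [r \<odot>\<^bsub>P\<^esub> p])) = r * E [a, b] (d 1 (word_class [p]))"
    if "p \<in> ideal0 P" for r p
    using that closed[OF that] d_smult[of "word_class [p]" 1 r] E_smult[of "d 1 (word_class [p])" 2 "[a, b]" r]
    unfolding word_class_smult[OF that] by (simp add: numeral_2_eq_2)
  {
    case zero
    show ?case
      using scaled[of "\<zero>\<^bsub>P\<^esub>" 0] by (simp add: zero_smult)
  next
    case (var x)
    then show ?case
      by (simp add: hirsch_group_mult gen_def)
  next
    case (add p q)
    then show ?case
      using closed[of p] closed[of q] d_add[of "word_class [p]" 1 "word_class [q]"]
        E_add[of "d 1 (word_class [p])" 2 "d 1 (word_class [q])" "[a, b]"]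
      unfolding word_class_add[OF add(1,2)] by (simp add: numeral_2_eq_2)
  next
    case (mult p q)
    let ?p = "word_class [p]" and ?q = "word_class [q]"
    note c = closed[OF mult(1)] closed[OF mult(2)]
    have cups: "cup M 1 1 ?p ?q \<in> comps M 2" "cup M 1 1 ?q ?p \<in> comps M 2"
      using cup_comps[OF c(1,3)] cup_comps[OF c(3,1)] by (simp_all add: numeral_2_eq_2)
    have dcups: "dcup1 M (d 1 ?p) ?q \<in> comps M 2" "dcup1 M (d 1 ?q) ?p \<in> comps M 2"
      "circ M (d 1 ?p) (d 1 ?q) \<in> comps M 2"
      using c dcup1_decomposables circ_decomposables unfolding decomposables_M by auto
    have Ecup: "E [a, b] (cup M 1 1 ?p ?q) = evl P p a * evl P q b"
      "E [a, b] (cup M 1 1 ?q ?p) = evl P q a * evl P p b"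
      using E_cup[OF c(1,3), of "[a, b]"] E_cup[OF c(3,1), of "[a, b]"] by auto
    have "d 1 (cup1 M ?p ?q) = (\<ominus>\<^bsub>comp M 2\<^esub> cup M 1 1 ?p ?q) \<ominus>\<^bsub>comp M 2\<^esub> cup M 1 1 ?q ?p
        \<oplus>\<^bsub>comp M 2\<^esub> dcup1 M (d 1 ?p) ?q \<oplus>\<^bsub>comp M 2\<^esub> dcup1 M (d 1 ?q) ?p
        \<ominus>\<^bsub>comp M 2\<^esub> circ M (d 1 ?p) (d 1 ?q)"
      using dga c unfolding binomial_cup1_dga_def decomposables_M diff_M by blast
    then have *: "E [a, b] (d 1 (word_class [p \<otimes>\<^bsub>P\<^esub> q])) =
        - (evl P p a * evl P q b) - evl P q a * evl P p b
        + E [a, b] (d 1 ?p) * (evl P q a + evl P q b) + E [a, b] (d 1 ?q) * (evl P p a + evl P p b)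
        - E [a, b] (d 1 ?p) * E [a, b] (d 1 ?q)"
      using c cups dcups Ecup unfolding cup1_word_class[OF mult(1,2)]
      by (simp add: E_a_minus E_add E_a_inv E_dcup1 E_circ)
    show ?case
      unfolding * mult(3,4) using mult(1,2) by (simp add: algebra_simps)
  next
    case (smult r p)
    then show ?case
      by (simp only: scaled) (simp add: algebra_simps)
  next
    case (divide r p)
    then have "r * E [a, b] (d 1 (word_class [p])) =
        r * (evl P p a + evl P p b - evl P p (a \<otimes>\<^bsub>G\<^esub> b))"
      by (simp only: scaled) (simp add: algebra_simps)
    then show ?case
      using divide by simp
  }
qed

text \<open>
  Induction on the word, splitting off its first letter \<open>q\<close>: in the Leibniz rule for \<open>q \<otimes> w\<close>, the term
  \<open>dq \<otimes> w\<close> contributes the faces \<open>d\<^sub>0\<close> and \<open>d\<^sub>1\<close> and one more summand.  This summand cancels the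
  one from the face \<open>d\<^sub>0\<close> of \<open>dw\<close> in \<open>- q \<otimes> dw\<close>, whose remaining summands are the faces \<open>d\<^sub>2, d\<^sub>3, \<dots>\<close>.
\<close>

lemma E_d_word:
  assumes "set w \<subseteq> ideal0 P" "length as = Suc (length w)"
  shows "E as (d (length w) (word_class w)) =
    (\<Sum>i\<le>Suc (length w). (-1) ^ i * word_eval (face (bar G) (Suc (length w)) i as) w)"
  using assms
proof (induction w arbitrary: as)
  case Nil
  let ?u = "unit M"
  have u: "?u \<in> comps M 0" "d 0 ?u \<in> comps M 1"
    using word_class_comps[of "[]"] d_comps[of ?u 0] by (auto simp: unit_M)
  \<comment> \<open>The Leibniz rule for the product of the unit with itself forces its differential to vanish.\<close>
  have "d 0 ?u = d 0 ?u \<oplus>\<^bsub>comp M 1\<^esub> 1 \<odot>\<^bsub>comp M 1\<^esub> d 0 ?u"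
    using d_cup[OF u(1,1)] graded_M u by (simp add: graded_algebra_def)
  then have "E as (d 0 ?u) = E as (d 0 ?u) + 1 * E as (d 0 ?u)"
    using u Nil by (metis E_add E_smult One_nat_def length_0_conv list.size(3) smult_comps)
  then have "E as (d 0 ?u) = 0"
    by (metis add_cancel_right_right mult_1)
  then show ?case
    by (simp add: unit_M)
next
  case (Cons q w)
  then obtain a b cs where as: "as = a # b # cs" "length cs = length w"
    by (auto simp: length_Suc_conv)
  let ?n = "length w" and ?W = "word_class w" and ?q = "word_class [q]"
  let ?face = "\<lambda>i as. face (bar G) (length as) i as"
  let ?e = "word_eval cs w"
  have c: "?q \<in> comps M 1" "?W \<in> comps M ?n" "d 1 ?q \<in> comps M (Suc 1)" "d ?n ?W \<in> comps M (Suc ?n)"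
    using Cons.prems word_class_comps[of "[q]"] by (auto intro: d_comps)
  have c': "cup M (Suc 1) ?n (d 1 ?q) ?W \<in> comps M (Suc (1 + ?n))"
    "cup M 1 (Suc ?n) ?q (d ?n ?W) \<in> comps M (Suc (1 + ?n))"
    using cup_comps[OF c(3,2)] cup_comps[OF c(1,4)] by auto
  have len: "length as = Suc (1 + ?n)"
    using as by simp
  have "word_class (q # w) = cup M 1 ?n ?q ?W"
    using cup_word_class[of "[q]" w] Cons.prems by simp
  then have "E as (d (Suc ?n) (word_class (q # w))) =
      E as (cup M (Suc 1) ?n (d 1 ?q) ?W) - E as (cup M 1 (Suc ?n) ?q (d ?n ?W))"
    using d_cup[OF c(1,2)] c' len by (simp add: E_add E_smult)
  also have "\<dots> = E [a, b] (d 1 ?q) * ?e - evl P q a * E (b # cs) (d ?n ?W)"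
    using E_cup[OF c(3,2), of as] E_cup[OF c(1,4), of as] as by simp
  also have "\<dots> = (evl P q a + evl P q b - evl P q (a \<otimes>\<^bsub>G\<^esub> b)) * ?e - evl P q a *
      (\<Sum>i\<le>Suc ?n. (-1) ^ i * word_eval (?face i (b # cs)) w)"
    using Cons.IH[of "b # cs"] Cons.prems as E_d_degree_one[of q a b] by simp
  also have "\<dots> = evl P q b * ?e - evl P q (a \<otimes>\<^bsub>G\<^esub> b) * ?e
      - evl P q a * (\<Sum>i\<le>?n. (-1) ^ Suc i * word_eval (?face (Suc i) (b # cs)) w)"
    by (subst sum.atMost_Suc_shift) (simp add: bar_def as algebra_simps)
  also have "evl P q a * (\<Sum>i\<le>?n. (-1) ^ Suc i * word_eval (?face (Suc i) (b # cs)) w)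
      = - (\<Sum>i\<le>?n. (-1) ^ Suc (Suc i) * word_eval (?face (Suc (Suc i)) as) (q # w))"
    by (simp add: as face_bar_Cons sum_distrib_left mult_ac sum_negf)
  finally show ?case
    using as by (simp add: sum.atMost_Suc_shift del: sum.atMost_Suc) (simp add: bar_def)
qed

text \<open>Evaluation turns the differential into the coboundary of the bar construction.\<close>

lemma E_d:
  assumes "U \<in> comps M n" "length as = Suc n"
  shows "E as (d n U) = (\<Sum>i\<le>Suc n. (-1) ^ i * E (face (bar G) (Suc n) i as) U)"
  using assms(1)
proof (induction rule: comps_induct)
  have len: "length (face (bar G) (Suc n) i as) = n" if "i \<le> Suc n" for i
    using that assms(2) by (rule length_face_bar)
  {
    case zero
    have "\<zero>\<^bsub>comp M n\<^esub> = 0 \<odot>\<^bsub>comp M n\<^esub> \<zero>\<^bsub>comp M n\<^esub>"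
      using class_scale[of 0 n 0] by (simp add: zero_M free_words_zero scale_zero)
    then have "E as (d n \<zero>\<^bsub>comp M n\<^esub>) = 0"
      using d_smult[of "\<zero>\<^bsub>comp M n\<^esub>" n 0] E_smult[of "d n \<zero>\<^bsub>comp M n\<^esub>" "Suc n" as 0] assms(2)
      by (simp add: d_comps)
    then show ?case
      using len by (simp add: E_zero del: sum.atMost_Suc)
  next
    case (word w)
    then show ?case
      using E_d_word[of w as] assms(2) len by (simp del: sum.atMost_Suc)
  next
    case (add U V)
    then show ?case
      using len assms(2)
      by (simp add: d_add E_add[where n = n] E_add[where n = "Suc n"] d_comps distrib_left sum.distrib
          del: sum.atMost_Suc)
  next
    case (smult r U)
    then show ?case
      using len assms(2)
      by (simp add: d_smult E_smult[where n = n] E_smult[where n = "Suc n"] d_comps sum_distrib_left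
          mult_ac del: sum.atMost_Suc)
  }
qed

end


section \<open>Faces and edges\<close>

text \<open>
  The face maps of \<open>Y\<close> are maps \<open>Y\<^sub>n\<^sub>+\<^sub>1 \<rightarrow> Y\<^sub>n\<close>; the simplicial identities are not required.
  Only the proof that \<open>r(f)\<close> commutes with faces needs these identities for \<open>Y\<close>.  As \<open>bar H\<close> is closed
  under faces without associativity of \<open>H\<close>, it is never used that \<open>G(\<M>)\<close> is a group.
\<close>

definition face_closed :: "'y delta \<Rightarrow> bool" where
  "face_closed Y \<longleftrightarrow> (\<forall>n. \<forall>i\<le>Suc n. face Y (Suc n) i \<in> simplices Y (Suc n) \<rightarrow> simplices Y n)"

lemma delta_set_face_closed: "delta_set Y \<Longrightarrow> face_closed Y"
  by (simp add: delta_set_def face_closed_def)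

lemma face_closedD:
  "face_closed Y \<Longrightarrow> y \<in> simplices Y (Suc n) \<Longrightarrow> i \<le> Suc n \<Longrightarrow> face Y (Suc n) i y \<in> simplices Y n"
  by (auto simp: face_closed_def)

lemma face_face:
  "delta_set Y \<Longrightarrow> y \<in> simplices Y (Suc (Suc n)) \<Longrightarrow> i < j \<Longrightarrow> j \<le> Suc (Suc n) \<Longrightarrow>
    face Y (Suc n) i (face Y (Suc (Suc n)) j y) = face Y (Suc n) (j - 1) (face Y (Suc (Suc n)) i y)"
  by (simp add: delta_set_def)

lemma front_face_simplices:
  "face_closed Y \<Longrightarrow> y \<in> simplices Y (k + m) \<Longrightarrow> front_face Y k m y \<in> simplices Y k"
  by (induction m arbitrary: y) (auto simp: face_closedD)

lemma back_face_simplices: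
  "face_closed Y \<Longrightarrow> y \<in> simplices Y (k + m) \<Longrightarrow> back_face Y k m y \<in> simplices Y k"
  by (induction m arbitrary: y) (auto simp: face_closedD)

lemma edge_simplices:
  "face_closed Y \<Longrightarrow> y \<in> simplices Y n \<Longrightarrow> j < n \<Longrightarrow> edge Y n j y \<in> simplices Y 1"
  using front_face_simplices[of Y y "j + 1" "n - (j + 1)"]
    back_face_simplices[of Y "front_face Y (j + 1) (n - (j + 1)) y" 1 j] by (simp add: edge_def)

text \<open>How the passage to the first or last vertices commutes with a face map.\<close>

lemma front_face_face_ge:
  assumes "delta_set Y" "y \<in> simplices Y (Suc (k + m))" "k < i" "i \<le> Suc (k + m)"
  shows "front_face Y k m (face Y (Suc (k + m)) i y) = front_face Y k (Suc m) y"
  using assms(2-)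
proof (induction m arbitrary: y i)
  case 0
  then have "i = Suc k"
    by simp
  then show ?case
    by simp
next
  case (Suc m)
  let ?N = "Suc (Suc (k + m))"
  show ?case
  proof (cases "i = ?N")
    case False
    then have "face Y (Suc (k + m)) (Suc (k + m)) (face Y ?N i y) = face Y (Suc (k + m)) i (face Y ?N ?N y)"
      using face_face[OF assms(1), of y "k + m" i ?N] Suc.prems by simp
    moreover have "face Y ?N ?N y \<in> simplices Y (Suc (k + m))"
      using face_closedD[OF delta_set_face_closed[OF assms(1)], of y "Suc (k + m)"] Suc.prems by simp
    ultimately show ?thesis
      using Suc.IH[of "face Y ?N ?N y" i] Suc.prems False by simp
  qed simp
qed

lemma front_face_face_le:
  assumes "delta_set Y" "y \<in> simplices Y (Suc (k + m))" "i \<le> Suc k"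
  shows "front_face Y k m (face Y (Suc (k + m)) i y) = face Y (Suc k) i (front_face Y (Suc k) m y)"
  using assms(2-)
proof (induction m arbitrary: y)
  case (Suc m)
  let ?N = "Suc (Suc (k + m))"
  have "face Y (Suc (k + m)) (Suc (k + m)) (face Y ?N i y) = face Y (Suc (k + m)) i (face Y ?N ?N y)"
    using face_face[OF assms(1), of y "k + m" i ?N] Suc.prems by simp
  moreover have "face Y ?N ?N y \<in> simplices Y (Suc (k + m))"
    using face_closedD[OF delta_set_face_closed[OF assms(1)], of y "Suc (k + m)"] Suc.prems by simp
  ultimately show ?case
    using Suc.IH[of "face Y ?N ?N y"] Suc.prems by simp
qed simp

lemma back_face_face_le:
  assumes "delta_set Y" "y \<in> simplices Y (Suc (k + m))" "i \<le> m"
  shows "back_face Y k m (face Y (Suc (k + m)) i y) = back_face Y k (Suc m) y"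
  using assms(2-)
proof (induction m arbitrary: y i)
  case (Suc m)
  let ?N = "Suc (Suc (k + m))"
  show ?case
  proof (cases "i = 0")
    case False
    then have "face Y (Suc (k + m)) 0 (face Y ?N i y) = face Y (Suc (k + m)) (i - 1) (face Y ?N 0 y)"
      using face_face[OF assms(1), of y "k + m" 0 i] Suc.prems by simp
    moreover have "face Y ?N 0 y \<in> simplices Y (Suc (k + m))"
      using face_closedD[OF delta_set_face_closed[OF assms(1)], of y "Suc (k + m)"] Suc.prems by simp
    ultimately show ?thesis
      using Suc.IH[of "face Y ?N 0 y" "i - 1"] Suc.prems False by simp
  qed simp
qed simp

lemma back_face_face_ge:
  assumes "delta_set Y" "y \<in> simplices Y (Suc (k + m))" "m \<le> i" "i \<le> Suc (k + m)"
  shows "back_face Y k m (face Y (Suc (k + m)) i y) = face Y (Suc k) (i - m) (back_face Y (Suc k) m y)"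
  using assms(2-)
proof (induction m arbitrary: y i)
  case (Suc m)
  let ?N = "Suc (Suc (k + m))"
  have "face Y (Suc (k + m)) 0 (face Y ?N i y) = face Y (Suc (k + m)) (i - 1) (face Y ?N 0 y)"
    using face_face[OF assms(1), of y "k + m" 0 i] Suc.prems by simp
  moreover have "face Y ?N 0 y \<in> simplices Y (Suc (k + m))"
    using face_closedD[OF delta_set_face_closed[OF assms(1)], of y "Suc (k + m)"] Suc.prems by simp
  moreover have "m \<le> i - 1" "i - 1 \<le> Suc (k + m)"
    using Suc.prems by auto
  ultimately show ?case
    using Suc.IH[of "face Y ?N 0 y" "i - 1"] by simp
qed simp

text \<open>
  The edges of the face \<open>d\<^sub>i y\<close> are edges of \<open>y\<close>, except that \<open>(i - 1, i + 1)\<close> is the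
  long edge of the triangle \<open>(i - 1, i, i + 1)\<close>.
\<close>

lemma edge_face:
  assumes Y: "delta_set Y" and y: "y \<in> simplices Y (Suc n)" and i: "i \<le> Suc n" and j: "j < n"
  shows edge_face_less: "Suc j < i \<Longrightarrow> edge Y n j (face Y (Suc n) i y) = edge Y (Suc n) j y"
    and edge_face_greater: "i \<le> j \<Longrightarrow> edge Y n j (face Y (Suc n) i y) = edge Y (Suc n) (Suc j) y"
    and edge_face_eq: "i = Suc j \<Longrightarrow> \<exists>T\<in>simplices Y 2. face Y 2 2 T = edge Y (Suc n) j y \<and>
      face Y 2 0 T = edge Y (Suc n) (Suc j) y \<and> face Y 2 1 T = edge Y n j (face Y (Suc n) i y)"
proof -
  define m where "m = n - (j + 1)"
  then have n: "n = Suc j + m"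
    using j by simp
  let ?w = "front_face Y (Suc (Suc j)) m y"
  have w: "?w \<in> simplices Y (Suc (Suc j))"
    using y n by (intro front_face_simplices delta_set_face_closed Y) simp
  have edge_n: "edge Y n j z = back_face Y 1 j (front_face Y (Suc j) m z)" for z
    by (simp add: edge_def m_def)
  have edge_j: "edge Y (Suc n) j y = back_face Y 1 j (front_face Y (Suc j) (Suc m) y)"
    using n by (simp add: edge_def)
  have edge_Suc_j: "edge Y (Suc n) (Suc j) y = back_face Y 1 (Suc j) ?w"
    using n by (simp add: edge_def)
  have front_ge: "front_face Y (Suc j) m (face Y (Suc n) l y) = front_face Y (Suc j) (Suc m) y"
    if "Suc j < l" "l \<le> Suc n" for l
    using front_face_face_ge[OF Y, of y "Suc j" m l] that y n by simp
  have front_le: "front_face Y (Suc j) m (face Y (Suc n) l y) = face Y (Suc (Suc j)) l ?w"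
    if "l \<le> Suc (Suc j)" for l
    using front_face_face_le[OF Y, of y "Suc j" m l] that y n by simp
  show "edge Y n j (face Y (Suc n) i y) = edge Y (Suc n) j y" if "Suc j < i"
    using front_ge[OF that i] by (simp add: edge_n edge_j)
  have back_le: "back_face Y 1 j (face Y (Suc (Suc j)) l ?w) = edge Y (Suc n) (Suc j) y" if "l \<le> j" for l
    using back_face_face_le[OF Y, of ?w 1 j l] that w by (simp add: edge_Suc_j)
  show "edge Y n j (face Y (Suc n) i y) = edge Y (Suc n) (Suc j) y" if "i \<le> j"
    using front_le[of i] back_le[OF that] that by (simp add: edge_n)
  let ?T = "back_face Y 2 j ?w"
  have T: "?T \<in> simplices Y 2"
    using w by (intro back_face_simplices delta_set_face_closed Y) simp
  have back_ge: "back_face Y 1 j (face Y (Suc (Suc j)) l ?w) = face Y 2 (l - j) ?T"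
    if "j \<le> l" "l \<le> Suc (Suc j)" for l
    using back_face_face_ge[OF Y, of ?w 1 j l] that w by (simp add: numeral_2_eq_2)
  show "\<exists>T\<in>simplices Y 2. face Y 2 2 T = edge Y (Suc n) j y \<and>
      face Y 2 0 T = edge Y (Suc n) (Suc j) y \<and> face Y 2 1 T = edge Y n j (face Y (Suc n) i y)"
    if "i = Suc j"
  proof (intro bexI[OF _ T] conjI)
    show "face Y 2 2 ?T = edge Y (Suc n) j y"
      unfolding edge_j using back_ge[of "Suc (Suc j)"] front_le[of "Suc (Suc j)"] front_ge[of "Suc (Suc j)"] j
      by simp
    show "face Y 2 0 ?T = edge Y (Suc n) (Suc j) y"
      using back_ge[of j] back_le[of j] by simp
    show "face Y 2 1 ?T = edge Y n j (face Y (Suc n) i y)"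
      using back_ge[of "Suc j"] front_le[of "Suc j"] that by (simp add: edge_n)
  qed
qed

lemma delta_mapsD:
  assumes "t \<in> delta_maps Y Z"
  shows delta_maps_simplices: "y \<in> simplices Y n \<Longrightarrow> t n y \<in> simplices Z n"
    and delta_maps_undefined: "y \<notin> simplices Y n \<Longrightarrow> t n y = undefined"
    and delta_maps_face: "y \<in> simplices Y (Suc n) \<Longrightarrow> i \<le> Suc n \<Longrightarrow>
      t n (face Y (Suc n) i y) = face Z (Suc n) i (t (Suc n) y)"
  using assms by (auto simp: delta_maps_def PiE_def extensional_def)

lemma delta_maps_front_face:
  "face_closed Y \<Longrightarrow> t \<in> delta_maps Y Z \<Longrightarrow> y \<in> simplices Y (k + m) \<Longrightarrow>
    t k (front_face Y k m y) = front_face Z k m (t (k + m) y)"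
  by (induction m arbitrary: y) (auto simp: face_closedD delta_maps_face)

lemma delta_maps_back_face:
  "face_closed Y \<Longrightarrow> t \<in> delta_maps Y Z \<Longrightarrow> y \<in> simplices Y (k + m) \<Longrightarrow>
    t k (back_face Y k m y) = back_face Z k m (t (k + m) y)"
  by (induction m arbitrary: y) (auto simp: face_closedD delta_maps_face)

lemma delta_maps_edge:
  assumes "face_closed Y" "t \<in> delta_maps Y Z" "y \<in> simplices Y n" "j < n"
  shows "t 1 (edge Y n j y) = edge Z n j (t n y)"
proof -
  let ?y = "front_face Y (j + 1) (n - (j + 1)) y"
  have y: "y \<in> simplices Y ((j + 1) + (n - (j + 1)))"
    using assms by simp
  then have "?y \<in> simplices Y (1 + j)"
    using front_face_simplices[OF assms(1) y] by simp
  then show ?thesis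
    using delta_maps_back_face[OF assms(1,2), of ?y 1 j] delta_maps_front_face[OF assms(1,2) y] assms(4)
    by (simp add: edge_def)
qed

lemma delta_comp_delta_maps:
  assumes "face_closed X" "t \<in> delta_maps X Y" "s \<in> delta_maps Y Z"
  shows "delta_comp X s t \<in> delta_maps X Z"
  using assms
  by (auto simp: delta_maps_def delta_comp_def compose_def face_closedD) (auto simp: PiE_def Pi_def)


subsection \<open>The bar construction\<close>

lemma simplices_bar: "s \<in> simplices (bar H) n \<longleftrightarrow> length s = n \<and> set s \<subseteq> carrier H"
  by (simp add: bar_def)

lemma nth_face_bar:
  assumes "length s = Suc n" "i \<le> Suc n" "j < n"
  shows "face (bar H) (Suc n) i s ! j =
    (if Suc j < i then s ! j else if Suc j = i then s ! j \<otimes>\<^bsub>H\<^esub> s ! Suc j else s ! Suc j)"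
proof -
  have "i + 1 + (j - (i - 1) - 1) = Suc j" if "0 < i" "i \<le> j"
    using that by simp
  then show ?thesis
    using assms by (auto simp: bar_def nth_tl nth_butlast nth_append nth_Cons')
qed

lemma front_face_bar: "length s = k + m \<Longrightarrow> front_face (bar H) k m s = take k s"
  by (induction m arbitrary: s) (simp_all add: bar_def take_butlast)

lemma back_face_bar: "length s = k + m \<Longrightarrow> back_face (bar H) k m s = drop m s"
  by (induction m arbitrary: s) (simp_all add: bar_def drop_Suc)

lemma edge_bar:
  assumes "length s = n" "j < n"
  shows "edge (bar H) n j s = [s ! j]"
proof -
  have "edge (bar H) n j s = drop j (take (Suc j) s)"
    using assms by (simp add: edge_def front_face_bar back_face_bar)
  also have "\<dots> = [s ! j]"
    using assms by (simp add: take_Suc_conv_app_nth)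
  finally show ?thesis .
qed

lemma face_closed_bar:
  assumes "\<And>a b. a \<in> carrier H \<Longrightarrow> b \<in> carrier H \<Longrightarrow> a \<otimes>\<^bsub>H\<^esub> b \<in> carrier H"
  shows "face_closed (bar H)"
proof -
  have "face (bar H) (Suc n) i s \<in> simplices (bar H) n"
    if s: "s \<in> simplices (bar H) (Suc n)" and i: "i \<le> Suc n" for n i s
  proof -
    have "length (face (bar H) (Suc n) i s) = n"
      using s i by (intro length_face_bar) (auto simp: simplices_bar)
    moreover have "s ! j \<in> carrier H" if "j < Suc n" for j
      using s that by (auto simp: simplices_bar)
    ultimately show ?thesis
      using nth_face_bar[of s n i _ H] s i assms
      by (auto simp: simplices_bar in_set_conv_nth)
  qed
  then show ?thesis
    by (auto simp: face_closed_def)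
qed


section \<open>The correspondence\<close>

lemma comps_cochains: "comps (cochains Y) n = (simplices Y n \<rightarrow>\<^sub>E UNIV)"
  and add_cochains: "u \<oplus>\<^bsub>comp (cochains Y) n\<^esub> v = (\<lambda>y\<in>simplices Y n. u y + v y)"
  and smult_cochains: "r \<odot>\<^bsub>comp (cochains Y) n\<^esub> u = (\<lambda>y\<in>simplices Y n. r * u y)"
  and unit_cochains: "unit (cochains Y) = (\<lambda>y\<in>simplices Y 0. 1)"
  and cup_cochains: "cup (cochains Y) i j u v =
    (\<lambda>y\<in>simplices Y (i + j). u (front_face Y i j y) * v (back_face Y j i y))"
  and cup1_cochains: "cup1 (cochains Y) u v = (\<lambda>e\<in>simplices Y 1. u e * v e)"
  and dcup1_cochains: "dcup1 (cochains Y) u c =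
    (\<lambda>y\<in>simplices Y 2. u y * (c (front_face Y 1 1 y) + c (back_face Y 1 1 y)))"
  and circ_cochains: "circ (cochains Y) u v = (\<lambda>y\<in>simplices Y 2. u y * v y)"
  and diff_cochains: "diff (cochains Y) n u =
    (\<lambda>y\<in>simplices Y (Suc n). \<Sum>i\<le>Suc n. (-1) ^ i * u (face Y (Suc n) i y))"
  by (simp_all add: cochains_def)

lemma dga_homD:
  assumes "f \<in> dga_hom A B"
  shows dga_hom_extensional: "f n \<in> extensional (comps A n)"
    and dga_hom_closed: "a \<in> comps A n \<Longrightarrow> f n a \<in> comps B n"
    and dga_hom_add: "a \<in> comps A n \<Longrightarrow> b \<in> comps A n \<Longrightarrow>
      f n (a \<oplus>\<^bsub>comp A n\<^esub> b) = f n a \<oplus>\<^bsub>comp B n\<^esub> f n b"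
    and dga_hom_smult: "a \<in> comps A n \<Longrightarrow> f n (r \<odot>\<^bsub>comp A n\<^esub> a) = r \<odot>\<^bsub>comp B n\<^esub> f n a"
    and dga_hom_unit: "f 0 (unit A) = unit B"
    and dga_hom_cup: "a \<in> comps A i \<Longrightarrow> b \<in> comps A j \<Longrightarrow>
      f (i + j) (cup A i j a b) = cup B i j (f i a) (f j b)"
    and dga_hom_cup1: "a \<in> comps A 1 \<Longrightarrow> b \<in> comps A 1 \<Longrightarrow>
      f 1 (cup1 A a b) = cup1 B (f 1 a) (f 1 b)"
    and dga_hom_dcup1: "u \<in> decomposables A \<Longrightarrow> c \<in> comps A 1 \<Longrightarrow>
      f 2 (dcup1 A u c) = dcup1 B (f 2 u) (f 1 c)"
    and dga_hom_circ: "u \<in> decomposables A \<Longrightarrow> v \<in> decomposables A \<Longrightarrow>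
      f 2 (circ A u v) = circ B (f 2 u) (f 2 v)"
    and dga_hom_diff: "a \<in> comps A n \<Longrightarrow> f (Suc n) (diff A n a) = diff B n (f n a)"
proof -
  have lin: "is_linear (comp A n) (comp B n) (f n)" for n
    using assms by (simp add: dga_hom_def)
  show "a \<in> comps A n \<Longrightarrow> f n a \<in> comps B n"
    "a \<in> comps A n \<Longrightarrow> b \<in> comps A n \<Longrightarrow> f n (a \<oplus>\<^bsub>comp A n\<^esub> b) = f n a \<oplus>\<^bsub>comp B n\<^esub> f n b"
    "a \<in> comps A n \<Longrightarrow> f n (r \<odot>\<^bsub>comp A n\<^esub> a) = r \<odot>\<^bsub>comp B n\<^esub> f n a"
    using is_linearD[OF lin] by simp_all
qed (use assms in \<open>simp_all add: dga_hom_def\<close>)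

context evaluation_dga
begin

text \<open>The element of \<open>G(\<M>)\<close> by which \<open>f\<close> labels the edge \<open>e\<close>.\<close>

abbreviation edge_label :: "(nat \<Rightarrow> ('r, 'q) tensor \<Rightarrow> 'y \<Rightarrow> 'r) \<Rightarrow> 'y \<Rightarrow> 'x \<Rightarrow> 'r" where
  "edge_label f e \<equiv> \<lambda>x\<in>vars P. f 1 (gen P x) e"

lemma to_delta_map_eq:
  "y \<in> simplices Y n \<Longrightarrow>
    to_delta_map P Y f n y = map (\<lambda>j. edge_label f (edge Y n j y)) [0..<n]"
  by (simp add: to_delta_map_def)

text \<open>The edges of the front face are defined by the same iterated faces, so no identity is needed.\<close>

lemma to_delta_map_Suc:
  assumes "face_closed Y" "y \<in> simplices Y (Suc m)"
  shows "to_delta_map P Y f (Suc m) y = to_delta_map P Y f m (front_face Y m 1 y) @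
    [edge_label f (back_face Y 1 m y)]"
proof -
  have "edge Y (Suc m) j y = edge Y m j (front_face Y m 1 y)" if "j < m" for j
  proof -
    have "Suc m - (j + 1) = Suc (m - (j + 1))" "j + 1 + Suc (m - (j + 1)) = Suc m"
      using that by auto
    then show ?thesis
      by (simp add: edge_def)
  qed
  moreover have "edge Y (Suc m) m y = back_face Y 1 m y"
    by (simp add: edge_def)
  moreover have "front_face Y m 1 y \<in> simplices Y m"
    using assms by (intro front_face_simplices) auto
  ultimately show ?thesis
    using assms by (simp add: to_delta_map_eq)
qed

lemma hom_degree_one:
  assumes "f \<in> dga_hom M (cochains Y)" "e \<in> simplices Y 1" "q \<in> ideal0 P"
  shows "f 1 (word_class [q]) e = evl P q (edge_label f e)"
proof (rule functional_eq_evl[of "\<lambda>q. f 1 (word_class [q]) e", OF _ _ _ _ assms(3)])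
  fix p q
  assume pq: "p \<in> ideal0 P" "q \<in> ideal0 P"
  then have c: "word_class [p] \<in> comps M 1" "word_class [q] \<in> comps M 1"
    using word_class_comps[of "[p]"] word_class_comps[of "[q]"] by auto
  show "f 1 (word_class [p \<oplus>\<^bsub>P\<^esub> q]) e = f 1 (word_class [p]) e + f 1 (word_class [q]) e"
    using dga_hom_add[OF assms(1) c] assms(2) unfolding word_class_add[OF pq] by (simp add: add_cochains)
  show "f 1 (word_class [p \<otimes>\<^bsub>P\<^esub> q]) e = f 1 (word_class [p]) e * f 1 (word_class [q]) e"
    using dga_hom_cup1[OF assms(1) c] assms(2) unfolding cup1_word_class[OF pq] by (simp add: cup1_cochains)
  show "f 1 (word_class [r \<odot>\<^bsub>P\<^esub> p]) e = r * f 1 (word_class [p]) e" for r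
    using dga_hom_smult[OF assms(1) c(1)] assms(2) unfolding word_class_smult[OF pq(1)]
    by (simp add: smult_cochains)
qed (simp add: gen_word_class)

lemma hom_word_class:
  assumes f: "f \<in> dga_hom M (cochains Y)" and Y: "face_closed Y"
    and "set w \<subseteq> ideal0 P" "y \<in> simplices Y (length w)"
  shows "f (length w) (word_class w) y = word_eval (to_delta_map P Y f (length w) y) w"
  using assms(3-)
proof (induction w arbitrary: y rule: rev_induct)
  case Nil
  then show ?case
    using dga_hom_unit[OF f] by (simp add: unit_M unit_cochains)
next
  case (snoc q w)
  let ?m = "length w"
  have y: "y \<in> simplices Y (?m + 1)"
    using snoc.prems by simp
  have front_eq: "front_face Y ?m 1 y \<in> simplices Y ?m"
    using y by (rule front_face_simplices[OF Y])
  have back_eq: "back_face Y 1 ?m y \<in> simplices Y 1"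
    using y by (intro back_face_simplices[OF Y]) (simp add: add.commute)
  have c: "word_class w \<in> comps M ?m" "word_class [q] \<in> comps M 1"
    using word_class_comps[of w] word_class_comps[of "[q]"] snoc.prems by auto
  have len: "length (to_delta_map P Y f ?m (front_face Y ?m 1 y)) = ?m"
    using front_eq by (simp add: to_delta_map_eq)
  have "word_class (w @ [q]) = cup M ?m 1 (word_class w) (word_class [q])"
    using cup_word_class[of w "[q]"] snoc.prems by simp
  then have "f (?m + 1) (word_class (w @ [q])) y =
      f ?m (word_class w) (front_face Y ?m 1 y) * f 1 (word_class [q]) (back_face Y 1 ?m y)"
    using dga_hom_cup[OF f c] y by (simp add: cup_cochains)
  also have "\<dots> = word_eval (to_delta_map P Y f ?m (front_face Y ?m 1 y)) w *
      evl P q (edge_label f (back_face Y 1 ?m y))"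
    using snoc.IH[OF _ front_eq] snoc.prems hom_degree_one[OF f back_eq, of q] by simp
  also have "\<dots> = word_eval (to_delta_map P Y f (?m + 1) y) (w @ [q])"
    using to_delta_map_Suc[OF Y, of y ?m f] y len by simp
  finally show ?case
    by simp
qed

text \<open>A morphism evaluates a tensor on a simplex by evaluating it at the edges.\<close>

lemma hom_eq_E:
  assumes f: "f \<in> dga_hom M (cochains Y)" and Y: "face_closed Y"
    and "U \<in> comps M n" and y: "y \<in> simplices Y n"
  shows "f n U y = E (to_delta_map P Y f n y) U"
  using assms(3)
proof (induction rule: comps_induct)
  have len: "length (to_delta_map P Y f n y) = n"
    using y by (simp add: to_delta_map_eq)
  {
    case zero
    have "\<zero>\<^bsub>comp M n\<^esub> = 0 \<odot>\<^bsub>comp M n\<^esub> \<zero>\<^bsub>comp M n\<^esub>"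
      using class_scale[of 0 n 0] by (simp add: zero_M free_words_zero scale_zero)
    then have "f n \<zero>\<^bsub>comp M n\<^esub> y = 0"
      using dga_hom_smult[OF f, of "\<zero>\<^bsub>comp M n\<^esub>" n 0] y by (simp add: smult_cochains)
    then show ?case
      using len by (simp add: E_zero)
  next
    case (word w)
    then show ?case
      using hom_word_class[OF f Y, of w y] y len by (simp add: E_word_class)
  next
    case (add U V)
    then show ?case
      using dga_hom_add[OF f add(1,2)] y len by (simp add: add_cochains E_add[where n = n])
  next
    case (smult r U)
    then show ?case
      using dga_hom_smult[OF f smult(1)] y len by (simp add: smult_cochains E_smult[where n = n])
  }
qed

lemma edge_label_triangle:
  assumes f: "f \<in> dga_hom M (cochains Y)" and Y: "face_closed Y" and T: "T \<in> simplices Y 2"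
  shows "edge_label f (face Y 2 1 T) =
    edge_label f (face Y 2 2 T) \<otimes>\<^bsub>G\<^esub> edge_label f (face Y 2 0 T)"
proof (rule ext)
  fix x
  let ?v = "edge_label f"
  have "[0..<2] = [0, Suc 0]"
    by (simp add: numeral_2_eq_2)
  then have "to_delta_map P Y f 2 T = [?v (face Y 2 2 T), ?v (face Y 2 0 T)]"
    using T by (simp add: to_delta_map_eq edge_def numeral_2_eq_2)
  moreover have "f 2 (d 1 (gen P x)) T = f 1 (gen P x) (face Y 2 0 T)
      - f 1 (gen P x) (face Y 2 1 T) + f 1 (gen P x) (face Y 2 2 T)" if "x \<in> vars P"
    using dga_hom_diff[OF f gen_comps[OF that]] T by (simp add: diff_cochains numeral_2_eq_2)
  moreover have "d 1 (gen P x) \<in> comps M 2" if "x \<in> vars P"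
    using d_comps[OF gen_comps[OF that]] by (simp add: numeral_2_eq_2)
  ultimately show "?v (face Y 2 1 T) x = (?v (face Y 2 2 T) \<otimes>\<^bsub>G\<^esub> ?v (face Y 2 0 T)) x"
    using hom_eq_E[OF f Y _ T, of "d 1 (gen P x)"] by (auto simp: hirsch_group_mult)
qed

lemma to_delta_map_delta_maps:
  assumes Y: "delta_set Y" and f: "f \<in> dga_hom M (cochains Y)"
  shows "to_delta_map P Y f \<in> delta_maps Y (bar G)"
proof -
  let ?r = "to_delta_map P Y f" and ?v = "edge_label f"
  note Y' = delta_set_face_closed[OF Y]
  have nth: "?r n y ! j = ?v (edge Y n j y)" and len: "length (?r n y) = n"
    if "y \<in> simplices Y n" "j < n" for n j y
    using that by (simp_all add: to_delta_map_eq)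
  have "?r n (face Y (Suc n) i y) = face (bar G) (Suc n) i (?r (Suc n) y)"
    if i: "i \<le> Suc n" and y: "y \<in> simplices Y (Suc n)" for n i y
  proof (rule nth_equalityI)
    have y': "face Y (Suc n) i y \<in> simplices Y n"
      using face_closedD[OF Y' y i] .
    have len': "length (?r (Suc n) y) = Suc n"
      using len[OF y, of 0] by simp
    show "length (?r n (face Y (Suc n) i y)) = length (face (bar G) (Suc n) i (?r (Suc n) y))"
      using length_face_bar[OF i len', where H = G] y' by (simp add: to_delta_map_eq)
    fix j
    assume "j < length (?r n (face Y (Suc n) i y))"
    then have j: "j < n"
      using y' by (simp add: to_delta_map_eq)
    have "?v (edge Y n j (face Y (Suc n) i y)) =
        ?v (edge Y (Suc n) j y) \<otimes>\<^bsub>G\<^esub> ?v (edge Y (Suc n) (Suc j) y)" if "i = Suc j"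
      using edge_face_eq[OF Y y i j that] edge_label_triangle[OF f Y'] by metis
    then show "?r n (face Y (Suc n) i y) ! j = face (bar G) (Suc n) i (?r (Suc n) y) ! j"
      unfolding nth_face_bar[OF len' i j] nth[OF y' j]
      using nth[OF y, of j] nth[OF y, of "Suc j"] j
        edge_face_less[OF Y y i j] edge_face_greater[OF Y y i j] by auto
  qed
  moreover have "?r n \<in> simplices Y n \<rightarrow>\<^sub>E simplices (bar G) n" for n
    by (auto simp: to_delta_map_def simplices_bar carrier_G)
  ultimately show ?thesis
    by (simp add: delta_maps_def)
qed

text \<open>The inverse of the map \<open>r\<close>.\<close>

definition of_delta_map ::
  "'y delta \<Rightarrow> (nat \<Rightarrow> 'y \<Rightarrow> ('x \<Rightarrow> 'r) list) \<Rightarrow> nat \<Rightarrow> ('r, 'q) tensor \<Rightarrow> 'y \<Rightarrow> 'r" where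
  "of_delta_map Y t = (\<lambda>n. \<lambda>U\<in>comps M n. \<lambda>y\<in>simplices Y n. E (t n y) U)"

lemma of_delta_map_hom:
  assumes Y: "face_closed Y" and t: "t \<in> delta_maps Y (bar G)"
  shows "of_delta_map Y t \<in> dga_hom M (cochains Y)"
proof -
  let ?f = "of_delta_map Y t"
  have len: "length (t n y) = n" if "y \<in> simplices Y n" for n y
    using delta_maps_simplices[OF t that] by (simp add: simplices_bar)
  have front_eq: "t i (front_face Y i j y) = take i (t (i + j) y)"
    and back_eq: "t j (back_face Y j i y) = drop i (t (i + j) y)"
    and front_in: "front_face Y i j y \<in> simplices Y i" and back_in: "back_face Y j i y \<in> simplices Y j"
    if "y \<in> simplices Y (i + j)" for i j y
    using that delta_maps_front_face[OF Y t, of y i j] delta_maps_back_face[OF Y t, of y j i]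
      front_face_simplices[OF Y, of y i j] back_face_simplices[OF Y, of y j i] len[OF that]
    by (simp_all add: front_face_bar back_face_bar add.commute)
  have two: "t 2 y = t 1 (front_face Y 1 1 y) @ t 1 (back_face Y 1 1 y)" if "y \<in> simplices Y 2" for y
    using front_eq[of y 1 1] back_eq[of y 1 1] that by (simp add: numeral_2_eq_2)
  have one: "\<exists>a. t 1 e = [a]" if "e \<in> simplices Y 1" for e
    using len[OF that] by (simp add: length_Suc_conv)
  have two_in: "front_face Y 1 1 y \<in> simplices Y 1" "back_face Y 1 1 y \<in> simplices Y 1"
    if "y \<in> simplices Y 2" for y
    using front_in[of y 1 1] back_in[of y 1 1] that by (simp_all add: numeral_2_eq_2)
  have "is_linear (comp M n) (comp (cochains Y) n) (?f n)" for n
    using len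
    by (auto simp: is_linear_def of_delta_map_def comps_cochains add_cochains smult_cochains
        E_add[where n = n] E_smult[where n = n] cong: restrict_cong)
  moreover have "?f 0 (unit M) = unit (cochains Y)"
    using word_class_comps[of "[]"] len[of _ 0]
    by (auto simp: of_delta_map_def unit_M unit_cochains cong: restrict_cong)
  moreover have "?f (i + j) (cup M i j U V) = cup (cochains Y) i j (?f i U) (?f j V)"
    if "U \<in> comps M i" "V \<in> comps M j" for i j U V
    using that cup_comps[OF that] len front_eq back_eq front_in back_in
    by (auto simp: of_delta_map_def cup_cochains E_cup cong: restrict_cong)
  moreover have "?f 1 (cup1 M U V) = cup1 (cochains Y) (?f 1 U) (?f 1 V)"
    if "U \<in> comps M 1" "V \<in> comps M 1" for U V
  proof -
    have "E (t 1 e) (cup1 M U V) = E (t 1 e) U * E (t 1 e) V" if "e \<in> simplices Y 1" for e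
      using one[OF that] E_cup1 \<open>U \<in> comps M 1\<close> \<open>V \<in> comps M 1\<close> by auto
    then show ?thesis
      unfolding of_delta_map_def cup1_cochains using that cup1_comps[OF that]
      by (simp cong: restrict_cong)
  qed
  moreover have "?f 2 (dcup1 M U V) = dcup1 (cochains Y) (?f 2 U) (?f 1 V)"
    if "U \<in> decomposables M" "V \<in> comps M 1" for U V
  proof -
    have U: "U \<in> comps M 2" "dcup1 M U V \<in> comps M 2"
      using that dcup1_decomposables[OF that] by (simp_all add: decomposables_M)
    have "E (t 2 y) (dcup1 M U V) =
        E (t 2 y) U * (E (t 1 (front_face Y 1 1 y)) V + E (t 1 (back_face Y 1 1 y)) V)"
      if y: "y \<in> simplices Y 2" for y
      using one[OF two_in(1)[OF y]] one[OF two_in(2)[OF y]] two[OF y] E_dcup1[OF U(1) \<open>V \<in> comps M 1\<close>]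
      by auto
    then show ?thesis
      unfolding of_delta_map_def dcup1_cochains using that(2) U two_in
      by (simp cong: restrict_cong)
  qed
  moreover have "?f 2 (circ M U V) = circ (cochains Y) (?f 2 U) (?f 2 V)"
    if "U \<in> decomposables M" "V \<in> decomposables M" for U V
  proof -
    have U: "U \<in> comps M 2" "V \<in> comps M 2" "circ M U V \<in> comps M 2"
      using that circ_decomposables[OF that] by (simp_all add: decomposables_M)
    have "E (t 2 y) (circ M U V) = E (t 2 y) U * E (t 2 y) V" if y: "y \<in> simplices Y 2" for y
      using one[OF two_in(1)[OF y]] one[OF two_in(2)[OF y]] two[OF y] E_circ[OF U(1,2)] by auto
    then show ?thesis
      unfolding of_delta_map_def circ_cochains using U by (simp cong: restrict_cong)
  qed
  moreover have "?f (Suc n) (d n U) = diff (cochains Y) n (?f n U)" if "U \<in> comps M n" for n U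
  proof -
    have "E (t (Suc n) y) (d n U) = (\<Sum>i\<le>Suc n. (-1) ^ i * ?f n U (face Y (Suc n) i y))"
      if y: "y \<in> simplices Y (Suc n)" for y
      unfolding E_d[OF \<open>U \<in> comps M n\<close> len[OF y]]
      using delta_maps_face[OF t y] face_closedD[OF Y y] \<open>U \<in> comps M n\<close>
      by (intro sum.cong) (auto simp: of_delta_map_def)
    then have "(\<lambda>y\<in>simplices Y (Suc n). E (t (Suc n) y) (d n U)) = diff (cochains Y) n (?f n U)"
      unfolding diff_cochains by (intro restrict_ext)
    then show ?thesis
      using d_comps[OF that] by (simp add: of_delta_map_def)
  qed
  moreover have "?f n \<in> extensional (comps M n)" for n
    by (simp add: of_delta_map_def)
  ultimately show ?thesis
    unfolding dga_hom_def diff_M by blast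
qed

lemma to_delta_map_of_delta_map:
  assumes Y: "face_closed Y" and t: "t \<in> delta_maps Y (bar G)"
  shows "to_delta_map P Y (of_delta_map Y t) = t"
proof (intro ext)
  fix n y
  show "to_delta_map P Y (of_delta_map Y t) n y = t n y"
  proof (cases "y \<in> simplices Y n")
    case True
    have ty: "length (t n y) = n" "set (t n y) \<subseteq> carrier G"
      using delta_maps_simplices[OF t True] by (simp_all add: simplices_bar)
    have "edge_label (of_delta_map Y t) (edge Y n j y) = t n y ! j" if j: "j < n" for j
    proof (rule ext)
      fix x
      have "t n y ! j \<in> carrier G"
        using ty j by auto
      moreover have "t 1 (edge Y n j y) = [t n y ! j]"
        using delta_maps_edge[OF Y t True j] edge_bar[of "t n y" n j G] ty j by simp
      ultimately show "edge_label (of_delta_map Y t) (edge Y n j y) x = (t n y ! j) x"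
        using edge_simplices[OF Y True j] gen_comps[of x]
        by (auto simp: of_delta_map_def carrier_G gen_def PiE_def extensional_def)
    qed
    then show ?thesis
      using True ty by (intro nth_equalityI) (simp_all add: to_delta_map_eq)
  next
    case False
    then show ?thesis
      using delta_maps_undefined[OF t] by (simp add: to_delta_map_def)
  qed
qed

lemma hom_eqI:
  assumes "f \<in> dga_hom M (cochains Y)"
    and "\<And>n U. U \<notin> comps M n \<Longrightarrow> g n U = undefined"
    and "\<And>n U. U \<in> comps M n \<Longrightarrow> g n U \<in> extensional (simplices Y n)"
    and "\<And>n U y. U \<in> comps M n \<Longrightarrow> y \<in> simplices Y n \<Longrightarrow> f n U y = g n U y"
  shows "f = g"
proof (intro ext)
  fix n U y
  show "f n U y = g n U y"
  proof (cases "U \<in> comps M n")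
    case True
    then have "f n U \<in> extensional (simplices Y n)"
      using dga_hom_closed[OF assms(1)] by (simp add: comps_cochains PiE_def)
    then show ?thesis
      using assms(3,4) True by (cases "y \<in> simplices Y n") (auto simp: extensional_def)
  next
    case False
    then show ?thesis
      using assms(2) dga_hom_extensional[OF assms(1), of n] by (auto simp: extensional_def)
  qed
qed

lemma of_delta_map_to_delta_map:
  assumes "f \<in> dga_hom M (cochains Y)" "face_closed Y"
  shows "of_delta_map Y (to_delta_map P Y f) = f"
  by (rule hom_eqI[OF assms(1), symmetric]) (auto simp: of_delta_map_def hom_eq_E[OF assms])

lemma bij_betw_to_delta_map:
  assumes "delta_set Y"
  shows "bij_betw (to_delta_map P Y) (dga_hom M (cochains Y)) (delta_maps Y (bar G))"
proof (rule bij_betw_byWitness[where f' = "of_delta_map Y"])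
qed (use assms in \<open>auto intro: of_delta_map_to_delta_map to_delta_map_of_delta_map
    to_delta_map_delta_maps of_delta_map_hom delta_set_face_closed\<close>)

lemma face_closed_bar_G: "face_closed (bar G)"
  by (rule face_closed_bar) (auto simp: carrier_G hirsch_group_mult)


subsection \<open>The canonical morphism\<close>

lemma canonical_morphism_eq_E:
  assumes "is_canonical_morphism P d \<psi>" "U \<in> comps M n" "s \<in> simplices (bar G) n"
  shows "\<psi> n U s = E s U"
proof -
  have \<psi>: "\<psi> \<in> dga_hom M (cochains (bar G))"
    and gen: "\<And>x a. x \<in> vars P \<Longrightarrow> a \<in> carrier G \<Longrightarrow> \<psi> 1 (gen P x) [a] = a x"
    using assms(1) by (auto simp: is_canonical_morphism_def)
  have "edge_label \<psi> (edge (bar G) n j s) = s ! j" if j: "j < n" for j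
  proof (rule ext)
    fix x
    have "s ! j \<in> carrier G" "edge (bar G) n j s = [s ! j]"
      using assms(3) j by (auto simp: simplices_bar edge_bar)
    then show "edge_label \<psi> (edge (bar G) n j s) x = (s ! j) x"
      using gen[of x "s ! j"] by (auto simp: carrier_G PiE_def extensional_def)
  qed
  then have "to_delta_map P (bar G) \<psi> n s = s"
    using assms(3) by (intro nth_equalityI) (auto simp: to_delta_map_eq simplices_bar)
  then show ?thesis
    using hom_eq_E[OF \<psi> face_closed_bar_G assms(2,3)] by simp
qed

lemma canonical_morphism_exists: "\<exists>\<psi>. is_canonical_morphism P d \<psi>"
proof -
  let ?id = "\<lambda>n. \<lambda>s\<in>simplices (bar G) n. s"
  have id: "?id \<in> delta_maps (bar G) (bar G)"
    by (auto simp: delta_maps_def face_closedD[OF face_closed_bar_G])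
  have "of_delta_map (bar G) ?id 1 (gen P x) [a] = a x" if "x \<in> vars P" "a \<in> carrier G" for x a
    using that gen_comps[OF that(1)] by (simp add: of_delta_map_def simplices_bar gen_def)
  then show ?thesis
    using of_delta_map_hom[OF face_closed_bar_G id] unfolding is_canonical_morphism_def by blast
qed

lemma canonical_morphism_unique: "\<exists>!\<psi>. is_canonical_morphism P d \<psi>"
proof -
  have "\<psi> = \<phi>" if \<psi>: "is_canonical_morphism P d \<psi>" and \<phi>: "is_canonical_morphism P d \<phi>" for \<psi> \<phi>
  proof -
    have hom: "\<psi> \<in> dga_hom M (cochains (bar G))" "\<phi> \<in> dga_hom M (cochains (bar G))"
      using \<psi> \<phi> by (auto simp: is_canonical_morphism_def)
    show ?thesis
      using dga_hom_extensional[OF hom(2)] dga_hom_closed[OF hom(2)]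
        canonical_morphism_eq_E[OF \<psi>] canonical_morphism_eq_E[OF \<phi>]
      by (intro hom_eqI[OF hom(1)]) (auto simp: extensional_def comps_cochains PiE_def)
  qed
  then show ?thesis
    using canonical_morphism_exists by blast
qed

lemma hom_factors_through_canonical_morphism:
  assumes Y: "delta_set Y" and \<psi>: "is_canonical_morphism P d \<psi>" and f: "f \<in> dga_hom M (cochains Y)"
  shows "f = dga_comp M (pullback Y (bar G) (to_delta_map P Y f)) \<psi>"
proof (rule hom_eqI[OF f])
  have "\<psi> \<in> dga_hom M (cochains (bar G))"
    using \<psi> by (simp add: is_canonical_morphism_def)
  then have eq: "dga_comp M (pullback Y (bar G) (to_delta_map P Y f)) \<psi> n U =
      (\<lambda>y\<in>simplices Y n. \<psi> n U (to_delta_map P Y f n y))" if "U \<in> comps M n" for n U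
    using that dga_hom_closed[of \<psi> M "cochains (bar G)" U n]
    by (simp add: dga_comp_def compose_def pullback_def comps_cochains)
  show "dga_comp M (pullback Y (bar G) (to_delta_map P Y f)) \<psi> n U \<in> extensional (simplices Y n)"
    if "U \<in> comps M n" for n U
    using eq[OF that] by simp
  show "f n U y = dga_comp M (pullback Y (bar G) (to_delta_map P Y f)) \<psi> n U y"
    if "U \<in> comps M n" "y \<in> simplices Y n" for n U y
    using that eq[OF that(1)] hom_eq_E[OF f delta_set_face_closed[OF Y] that]
      canonical_morphism_eq_E[OF \<psi> that(1) delta_maps_simplices[OF to_delta_map_delta_maps[OF Y f] that(2)]]
    by simp
qed (simp add: dga_comp_def compose_def)


subsection \<open>Naturality\<close>

lemma pullback_hom:
  assumes Y: "face_closed Y" and Z: "delta_set Z" and t: "t \<in> delta_maps Y Z"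
    and f: "f \<in> dga_hom M (cochains Z)"
  shows "dga_comp M (pullback Y Z t) f \<in> dga_hom M (cochains Y)"
    and "to_delta_map P Y (dga_comp M (pullback Y Z t) f) = delta_comp Y (to_delta_map P Z f) t"
proof -
  let ?s = "delta_comp Y (to_delta_map P Z f) t"
  have s: "?s \<in> delta_maps Y (bar G)"
    by (rule delta_comp_delta_maps[OF Y t to_delta_map_delta_maps[OF Z f]])
  have eq: "dga_comp M (pullback Y Z t) f n U = (\<lambda>y\<in>simplices Y n. f n U (t n y))" if "U \<in> comps M n" for n U
    using that dga_hom_closed[OF f that] by (simp add: dga_comp_def compose_def pullback_def comps_cochains)
  have "of_delta_map Y ?s = dga_comp M (pullback Y Z t) f"
  proof (rule hom_eqI[OF of_delta_map_hom[OF Y s]])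
    show "dga_comp M (pullback Y Z t) f n U \<in> extensional (simplices Y n)" if "U \<in> comps M n" for n U
      using eq[OF that] by simp
    show "of_delta_map Y ?s n U y = dga_comp M (pullback Y Z t) f n U y"
      if "U \<in> comps M n" "y \<in> simplices Y n" for n U y
      using that eq[OF that(1)] delta_maps_simplices[OF t that(2)]
        hom_eq_E[OF f delta_set_face_closed[OF Z] that(1), of "t n y"]
      by (simp add: of_delta_map_def delta_comp_def compose_def)
  qed (simp add: dga_comp_def compose_def)
  then show "dga_comp M (pullback Y Z t) f \<in> dga_hom M (cochains Y)"
    and "to_delta_map P Y (dga_comp M (pullback Y Z t) f) = ?s"
    using of_delta_map_hom[OF Y s] to_delta_map_of_delta_map[OF Y s] by simp_all
qed

end

lemma dga_comp_hom:
  assumes M: "evaluation_dga P d" and M': "evaluation_dga P' d'"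
    and \<alpha>: "\<alpha> \<in> dga_hom (free_dga P d) (free_dga P' d')" and f: "f \<in> dga_hom (free_dga P' d') B"
  shows "dga_comp (free_dga P d) f \<alpha> \<in> dga_hom (free_dga P d) B"
proof -
  interpret M: evaluation_dga P d by (rule M)
  interpret M': evaluation_dga P' d' by (rule M')
  let ?h = "dga_comp (free_dga P d) f \<alpha>"
  have eq: "?h n U = f n (\<alpha> n U)" if "U \<in> comps M.M n" for n U
    using that by (simp add: dga_comp_def compose_def)
  note closed = dga_hom_closed[OF \<alpha>]
  have dec: "\<alpha> 2 U \<in> decomposables M'.M" "U \<in> comps M.M 2" if "U \<in> decomposables M.M" for U
    using that closed by (simp_all add: M.decomposables_M M'.decomposables_M)
  have "is_linear (comp M.M n) (comp B n) (?h n)" for n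
    using closed dga_hom_closed[OF f] by (auto simp: is_linear_def eq dga_hom_add[OF \<alpha>] dga_hom_add[OF f]
        dga_hom_smult[OF \<alpha>] dga_hom_smult[OF f])
  moreover have "?h 0 (unit M.M) = unit B"
    by (simp add: eq M.unit_comps dga_hom_unit[OF \<alpha>] dga_hom_unit[OF f])
  moreover have "?h (i + j) (cup M.M i j U V) = cup B i j (?h i U) (?h j V)"
    if "U \<in> comps M.M i" "V \<in> comps M.M j" for i j U V
    using that closed M.cup_comps[OF that] by (simp add: eq dga_hom_cup[OF \<alpha>] dga_hom_cup[OF f])
  moreover have "?h 1 (cup1 M.M U V) = cup1 B (?h 1 U) (?h 1 V)"
    if "U \<in> comps M.M 1" "V \<in> comps M.M 1" for U V
    using that M.cup1_comps[OF that] dga_hom_cup1[OF \<alpha> that]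
      dga_hom_cup1[OF f closed[OF that(1)] closed[OF that(2)]] by (simp add: eq)
  moreover have "?h 2 (dcup1 M.M U V) = dcup1 B (?h 2 U) (?h 1 V)"
    if "U \<in> decomposables M.M" "V \<in> comps M.M 1" for U V
    using that dec(2)[OF M.dcup1_decomposables[OF that]] dga_hom_dcup1[OF \<alpha> that]
      dga_hom_dcup1[OF f dec(1)[OF that(1)] closed[OF that(2)]] dec(2)[OF that(1)] by (simp add: eq)
  moreover have "?h 2 (circ M.M U V) = circ B (?h 2 U) (?h 2 V)"
    if "U \<in> decomposables M.M" "V \<in> decomposables M.M" for U V
    using that dec(2)[OF M.circ_decomposables[OF that]] dga_hom_circ[OF \<alpha> that]
      dga_hom_circ[OF f dec(1)[OF that(1)] dec(1)[OF that(2)]] dec(2)[OF that(1)] dec(2)[OF that(2)]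
    by (simp add: eq)
  moreover have "?h (Suc n) (diff M.M n U) = diff B n (?h n U)" if "U \<in> comps M.M n" for n U
    using that closed[OF that] M.d_comps[OF that] dga_hom_diff[OF \<alpha> that] dga_hom_diff[OF f closed[OF that]]
    by (simp add: eq)
  moreover have "?h n \<in> extensional (comps M.M n)" for n
    by (simp add: dga_comp_def)
  ultimately show ?thesis
    unfolding dga_hom_def by blast
qed

lemma to_delta_map_dga_comp:
  assumes M: "evaluation_dga P d" and M': "evaluation_dga P' d'"
    and \<alpha>: "\<alpha> \<in> dga_hom (free_dga P d) (free_dga P' d')"
    and Y: "delta_set Y" and f: "f \<in> dga_hom (free_dga P' d') (cochains Y)"
  shows "to_delta_map P Y (dga_comp (free_dga P d) f \<alpha>) =
    delta_comp Y (bar_map (hirsch_group P' d') (induced_hom P P' \<alpha>)) (to_delta_map P' Y f)"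
proof (intro ext)
  fix n y
  interpret M: evaluation_dga P d by (rule M)
  interpret M': evaluation_dga P' d' by (rule M')
  let ?h = "induced_hom P P' \<alpha>"
  note Y' = delta_set_face_closed[OF Y]
  show "to_delta_map P Y (dga_comp M.M f \<alpha>) n y =
    delta_comp Y (bar_map M'.G ?h) (to_delta_map P' Y f) n y"
  proof (cases "y \<in> simplices Y n")
    case True
    have "M.edge_label (dga_comp M.M f \<alpha>) e = ?h (M'.edge_label f e)"
      if e: "e \<in> simplices Y 1" for e
    proof -
      have "to_delta_map P' Y f 1 e = [M'.edge_label f e]"
        using e by (simp add: M'.to_delta_map_eq edge_def)
      then have "f 1 (\<alpha> 1 (gen P x)) e = tensor_eval P' [M'.edge_label f e] (\<alpha> 1 (gen P x))"
        if "x \<in> vars P" for x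
        using M'.hom_eq_E[OF f Y' dga_hom_closed[OF \<alpha> M.gen_comps[OF that]] e] by simp
      then show ?thesis
        using M.gen_comps by (auto simp: induced_hom_def dga_comp_def compose_def)
    qed
    then show ?thesis
      using True edge_simplices[OF Y' True]
        delta_maps_simplices[OF M'.to_delta_map_delta_maps[OF Y f] True]
      by (simp add: delta_comp_def compose_def bar_map_def M.to_delta_map_eq M'.to_delta_map_eq)
  next
    case False
    then show ?thesis
      by (simp add: to_delta_map_def delta_comp_def compose_def)
  qed
qed

text \<open>
  Multiplicativity is the triangle identity for the composite of \<open>\<alpha>\<close> with the canonical
  morphism of the target, on the simplex \<open>[a|b]\<close>.
\<close>

lemma induced_hom_hom:
  assumes M: "evaluation_dga P d" and M': "evaluation_dga P' d'"
    and \<alpha>: "\<alpha> \<in> dga_hom (free_dga P d) (free_dga P' d')"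
  shows "induced_hom P P' \<alpha> \<in> hom (hirsch_group P' d') (hirsch_group P d)"
proof -
  interpret M: evaluation_dga P d by (rule M)
  interpret M': evaluation_dga P' d' by (rule M')
  obtain \<psi> where \<psi>: "is_canonical_morphism P' d' \<psi>"
    using M'.canonical_morphism_exists by blast
  let ?h = "induced_hom P P' \<alpha>" and ?f = "dga_comp M.M \<psi> \<alpha>"
  have f: "?f \<in> dga_hom M.M (cochains (bar M'.G))"
    using \<psi> by (intro dga_comp_hom[OF M M' \<alpha>]) (simp add: is_canonical_morphism_def)
  have v: "M.edge_label ?f [a] = ?h a" if "a \<in> carrier M'.G" for a
    using that M.gen_comps dga_hom_closed[OF \<alpha> M.gen_comps] M'.canonical_morphism_eq_E[OF \<psi>, of _ 1 "[a]"]
    by (auto simp: dga_comp_def compose_def induced_hom_def M'.carrier_G simplices_bar)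
  have "?h (a \<otimes>\<^bsub>M'.G\<^esub> b) = ?h a \<otimes>\<^bsub>M.G\<^esub> ?h b" if "a \<in> carrier M'.G" "b \<in> carrier M'.G" for a b
  proof -
    have "a \<otimes>\<^bsub>M'.G\<^esub> b \<in> carrier M'.G"
      by (auto simp: M'.carrier_G M'.hirsch_group_mult)
    moreover have "[a, b] \<in> simplices (bar M'.G) 2"
      using that by (simp add: simplices_bar)
    ultimately show ?thesis
      using M.edge_label_triangle[OF f M'.face_closed_bar_G, of "[a, b]"] that v
      by (simp add: bar_def)
  qed
  moreover have "?h a \<in> carrier M.G" if "a \<in> carrier M'.G" for a
    using that by (simp add: induced_hom_def M.carrier_G M'.carrier_G)
  ultimately show ?thesis
    by (simp add: hom_def)
qed


subsection \<open>Colimits of Hirsch extensions\<close>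

lemma evaluation_dga_int_valued:
  assumes "hirsch_colimit int_valued X d"
  shows "evaluation_dga (int_valued X) d"
  using assms evaluation_algebra_int_valued
  by (auto simp: evaluation_dga_def evaluation_dga_axioms_def hirsch_colimit_def)

lemma evaluation_dga_mod_p_polys:
  assumes "hirsch_colimit mod_p_polys X d"
  shows "evaluation_dga (mod_p_polys X :: ('p::prime_card mod_ring, _, 'x) poly_alg) d"
  using assms evaluation_algebra_mod_p_polys
  by (auto simp: evaluation_dga_def evaluation_dga_axioms_def hirsch_colimit_def)

lemma vars_int_valued: "vars (int_valued X) = X"
  by (simp add: int_valued_def)

lemma vars_mod_p_polys: "vars (mod_p_polys X) = X"
  by (simp add: mod_p_polys_def Let_def)

text \<open>All clauses for one ring \<open>R\<close>, where \<open>F\<close> and \<open>F'\<close> form the degree-one algebra on two types of variables.\<close>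

lemma correspondence:
  fixes Y :: "'y delta" and X :: "'x set"
    and F :: "'x set \<Rightarrow> ('r::idom, 'q, 'x) poly_alg" and F' :: "'w set \<Rightarrow> ('r, 'q1, 'w) poly_alg"
  assumes Y: "delta_set Y" and M: "evaluation_dga (F X) d" and X: "vars (F X) = X"
    and M': "\<And>X' d'. hirsch_colimit F' X' d' \<Longrightarrow> evaluation_dga (F' X') d'"
  shows
    "let P = F X; M = free_dga P d; G = hirsch_group P d; r = to_delta_map P Y in
        bij_betw r (dga_hom M (cochains Y)) (delta_maps Y (bar G)) \<and>
        (\<forall>f\<in>dga_hom M (cochains Y). \<forall>n\<ge>1. \<forall>y\<in>simplices Y n.
           r f n y = map (\<lambda>j. \<lambda>x\<in>X. f 1 (gen P x) (edge Y n j y)) [0..<n]) \<and>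
        (\<exists>!\<psi>. is_canonical_morphism P d \<psi>) \<and>
        (\<forall>\<psi>. is_canonical_morphism P d \<psi> \<longrightarrow>
           (\<forall>f\<in>dga_hom M (cochains Y). f = dga_comp M (pullback Y (bar G) (r f)) \<psi>)) \<and>
        (\<forall>(Z :: 'z delta) t f. delta_set Z \<and> t \<in> delta_maps Y Z \<and> f \<in> dga_hom M (cochains Z) \<longrightarrow>
           dga_comp M (pullback Y Z t) f \<in> dga_hom M (cochains Y) \<and>
           r (dga_comp M (pullback Y Z t) f) = delta_comp Y (to_delta_map P Z f) t) \<and>
        (\<forall>(X' :: 'w set) d'. hirsch_colimit F' X' d' \<longrightarrow>
           (let P' = F' X'; M' = free_dga P' d'; G' = hirsch_group P' d' in
            \<forall>\<alpha>\<in>dga_hom M M'.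
              induced_hom P P' \<alpha> \<in> hom G' G \<and>
              (\<forall>f\<in>dga_hom M' (cochains Y).
                 dga_comp M f \<alpha> \<in> dga_hom M (cochains Y) \<and>
                 r (dga_comp M f \<alpha>) =
                   delta_comp Y (bar_map G' (induced_hom P P' \<alpha>)) (to_delta_map P' Y f))))"
proof -
  interpret evaluation_dga "F X" d
    by (rule M)
  note Y' = delta_set_face_closed[OF Y]
  have Z: "dga_comp M (pullback Y Z t) f \<in> dga_hom M (cochains Y) \<and>
      to_delta_map (F X) Y (dga_comp M (pullback Y Z t) f) = delta_comp Y (to_delta_map (F X) Z f) t"
    if "delta_set Z \<and> t \<in> delta_maps Y Z \<and> f \<in> dga_hom M (cochains Z)" for Z :: "'z delta" and t f
    using pullback_hom[OF Y', of Z t f] that by blast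
  show ?thesis
    unfolding Let_def
    using bij_betw_to_delta_map[OF Y] canonical_morphism_unique
      hom_factors_through_canonical_morphism[OF Y] Z
      induced_hom_hom[OF M M'] dga_comp_hom[OF M M'] to_delta_map_dga_comp[OF M M' _ Y]
    by (intro conjI allI impI ballI) (simp_all add: to_delta_map_eq X)
qed

theorem theorem7p5:
  fixes Y :: "'y delta"
  assumes "delta_set Y"
  shows
    "(\<forall>(X :: 'x set) d. hirsch_colimit int_valued X d \<longrightarrow>
       (let P = int_valued X; M = free_dga P d; G = hirsch_group P d; r = to_delta_map P Y in
        bij_betw r (dga_hom M (cochains Y)) (delta_maps Y (bar G)) \<and>
        (\<forall>f\<in>dga_hom M (cochains Y). \<forall>n\<ge>1. \<forall>y\<in>simplices Y n.
           r f n y = map (\<lambda>j. \<lambda>x\<in>X. f 1 (gen P x) (edge Y n j y)) [0..<n]) \<and>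
        (\<exists>!\<psi>. is_canonical_morphism P d \<psi>) \<and>
        (\<forall>\<psi>. is_canonical_morphism P d \<psi> \<longrightarrow>
           (\<forall>f\<in>dga_hom M (cochains Y). f = dga_comp M (pullback Y (bar G) (r f)) \<psi>)) \<and>
        (\<forall>(Z :: 'z delta) t f. delta_set Z \<and> t \<in> delta_maps Y Z \<and> f \<in> dga_hom M (cochains Z) \<longrightarrow>
           dga_comp M (pullback Y Z t) f \<in> dga_hom M (cochains Y) \<and>
           r (dga_comp M (pullback Y Z t) f) = delta_comp Y (to_delta_map P Z f) t) \<and>
        (\<forall>(X' :: 'w set) d'. hirsch_colimit int_valued X' d' \<longrightarrow>
           (let P' = int_valued X'; M' = free_dga P' d'; G' = hirsch_group P' d' in
            \<forall>\<alpha>\<in>dga_hom M M'.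
              induced_hom P P' \<alpha> \<in> hom G' G \<and>
              (\<forall>f\<in>dga_hom M' (cochains Y).
                 dga_comp M f \<alpha> \<in> dga_hom M (cochains Y) \<and>
                 r (dga_comp M f \<alpha>) =
                   delta_comp Y (bar_map G' (induced_hom P P' \<alpha>)) (to_delta_map P' Y f))))))
     \<and>
     (\<forall>(X :: 'x set) (d :: nat \<Rightarrow> ('p::prime_card mod_ring, _) tensor \<Rightarrow> _).
       hirsch_colimit mod_p_polys X d \<longrightarrow>
       (let P = mod_p_polys X; M = free_dga P d; G = hirsch_group P d; r = to_delta_map P Y in
        bij_betw r (dga_hom M (cochains Y)) (delta_maps Y (bar G)) \<and>
        (\<forall>f\<in>dga_hom M (cochains Y). \<forall>n\<ge>1. \<forall>y\<in>simplices Y n.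
           r f n y = map (\<lambda>j. \<lambda>x\<in>X. f 1 (gen P x) (edge Y n j y)) [0..<n]) \<and>
        (\<exists>!\<psi>. is_canonical_morphism P d \<psi>) \<and>
        (\<forall>\<psi>. is_canonical_morphism P d \<psi> \<longrightarrow>
           (\<forall>f\<in>dga_hom M (cochains Y). f = dga_comp M (pullback Y (bar G) (r f)) \<psi>)) \<and>
        (\<forall>(Z :: 'z delta) t f. delta_set Z \<and> t \<in> delta_maps Y Z \<and> f \<in> dga_hom M (cochains Z) \<longrightarrow>
           dga_comp M (pullback Y Z t) f \<in> dga_hom M (cochains Y) \<and>
           r (dga_comp M (pullback Y Z t) f) = delta_comp Y (to_delta_map P Z f) t) \<and>
        (\<forall>(X' :: 'w set) d'. hirsch_colimit mod_p_polys X' d' \<longrightarrow>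
           (let P' = mod_p_polys X'; M' = free_dga P' d'; G' = hirsch_group P' d' in
            \<forall>\<alpha>\<in>dga_hom M M'.
              induced_hom P P' \<alpha> \<in> hom G' G \<and>
              (\<forall>f\<in>dga_hom M' (cochains Y).
                 dga_comp M f \<alpha> \<in> dga_hom M (cochains Y) \<and>
                 r (dga_comp M f \<alpha>) =
                   delta_comp Y (bar_map G' (induced_hom P P' \<alpha>)) (to_delta_map P' Y f))))))"
proof (intro conjI allI impI, goal_cases)
  case (1 X d)
  show ?case
    by (rule correspondence[where F = int_valued and F' = int_valued, OF assms
          evaluation_dga_int_valued[OF 1] vars_int_valued evaluation_dga_int_valued])
next
  case (2 X d)
  show ?case
    by (rule correspondence[where F = mod_p_polys and F' = mod_p_polys, OF assms
          evaluation_dga_mod_p_polys[OF 2] vars_mod_p_polys evaluation_dga_mod_p_polys])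
qed

end
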